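(* Suppose that $\pi(\theta)=\|A^{-1}\cdot\theta\|_1$ for $\theta\in\mathbb R^k$, where $A$ is an invertible matrix and $\|\cdot\|_1$ is the $L_1$ norm; $k=\dim(\theta)$. Let $\Sigma$ be a positive definite $k\times k$ matrix. With $SURE$, $h^\lambda$, $\eta$, $J$, $A_J$ as defined in the context, the following holds: 1. As a function of $\lambda$, for every $R,\nu$, the graph of $SURE(\lambda,R,\nu)$ consists of at most $3^k$ continuous segments indexed by $\eta\in\{-1,0,1\}^k$. On each of these segments $\eta$ and $J=\{j:\eta_j\neq0\}$ are constant, $$\nabla g^\lambda=A_J(A_J'A_J)^{-1}A_J'-I,\qquad\|g^\lambda\|^2=\|\nabla g^\lambda\cdot\theta\|^2+\lambda^2\cdot\eta_J'(A_J'A_J)^{-1}\eta_J,$$ and $SURE(\lambda,R,\nu)$ is a monotonically increasing quadratic polynomial in $\lambda$ of the form $SURE(\lambda,R,\nu)=\text{const.}+\tfrac12\lambda^2\cdot\eta_J'(A_J'A_J)^{-1}\eta_J$. 2. $SURE$ scales with $R$ as follows: $$SURE(R\cdot\lambda,R,\nu)=\tfrac12\left[\operatorname{trace}(\Sigma)+R^2\cdot\|g^\lambda(\nu)\|^2+2\operatorname{trace}(\nabla g^\lambda(\nu)\cdot\Sigma)\right].$$ Given $\nu$, let $\lambda_1<\lambda_2<\dots<\lambda_m$ ($m\le3^k$) be the local minimizers of $SURE(\lambda,1,\nu)$, corresponding to values of $\lambda$ where $\eta$ changes. The local minimizers of $SURE(\lambda,R,\nu)$ are then given by $R\lambda_1,R\lambda_2,\dots,R\lambda_m$.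 3. Let $\lambda(R,\nu)=\arg\min_{\lambda\in\mathbb R^+}SURE(\lambda,R,\nu)$. Then, given $\nu$, $\lambda(R,\nu)=R\cdot\lambda_{j(R)}$, where $j(R)$ is a monotonically decreasing mapping from $R$ to $\{1,2,\dots,m\}$, and $\lambda_1,\dots,\lambda_m$ are as in item 2. The graph of $R\mapsto\lambda(R,\nu)$ thus follows a piecewise linear "sawtooth" pattern with at most $3^k$ jumps. 4. Fix $\nu$ and $R$ such that $\lambda(\cdot)$ is continuous in $R$ at $(R,\nu)$, and let $\bar\lambda=\lambda(R,\nu)$ be such that $\eta\neq0$. Then the minimum of $SURE$ is well separated: for any $\epsilon>0$, $$\inf_{\lambda\in\mathbb R^+\setminus[\bar\lambda-\epsilon,\bar\lambda+\epsilon]}SURE(\lambda,R,\nu)-SURE(\bar\lambda,R,\nu)>0 .$$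
   Context: $\mathbb R^+=[0,\infty)$. $\|\cdot\|$ is the Euclidean norm; $'$ denotes transpose. $g^\lambda(\theta)=\arg\min_g[\tfrac12\|g\|^2+\lambda\pi(\theta+g)]$; $\nabla g^\lambda(\theta)$ is its derivative in $\theta$ where it exists (the paper's general convention sets $\nabla g^\lambda(\theta)=0$ at points of non-differentiability). $SURE(\lambda,\theta)=SURE(\lambda,\theta,\Sigma)=\tfrac12[\operatorname{trace}(\Sigma)+\|g^\lambda(\theta)\|^2+2\operatorname{trace}(\nabla g^\lambda(\theta)\cdot\Sigma)]$. Polar coordinates: for $\theta\ne0$, $R=\|\theta\|>0$, $\nu=\theta/R$ (a unit vector), and $SURE(\lambda,R,\nu)=SURE(\lambda,R\nu)$. $h^\lambda(\theta)=A^{-1}(\theta+g^\lambda(\theta))=\arg\min_h[\tfrac12\|Ah-\theta\|^2+\lambda\|h\|_1]$. For given $\lambda,\theta$: $\eta\in\{-1,0,1\}^k$ is the sign vector $\eta_j=\operatorname{sign}(h_j^\lambda(\theta))$, $J=\{j:\eta_j\ne0\}$ is the active set, and $A_J$ is the submatrix of columns of $A$ indexed by $J$; the solution satisfies $h_J^\lambda(\theta)=(A_J'A_J)^{-1}[A_J'\theta-\lambda\eta_J]$. If the minimizer over $\lambda$ is not unique, the smallest is taken.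
   Formalization: Where g^λ is not differentiable, and at λ=0, ∇g^λ is A_J(A_J'A_J)^{-1}A_J'−I for the current η, since the value 0 leaves no smallest minimizer; a flat stretch of SURE counts as one local minimizer, its left end; λ=0 may be a local minimizer without η changing there. *)

theory Defs
  imports "HOL-Analysis.Analysis"
begin

definition l1_norm :: "real^'k \<Rightarrow> real" where
  "l1_norm x = (\<Sum>i\<in>UNIV. \<bar>x $ i\<bar>)"

definition pos_def :: "real^'k^'k \<Rightarrow> bool" where
  "pos_def S \<longleftrightarrow> transpose S = S \<and> (\<forall>x. x \<noteq> 0 \<longrightarrow> 0 < x \<bullet> (S *v x))"

definition penalty :: "real^'k^'k \<Rightarrow> real^'k \<Rightarrow> real" where
  "penalty A \<theta> = l1_norm (matrix_inv A *v \<theta>)"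

text \<open>For invertible \<open>A\<close> and \<open>lam \<ge> 0\<close> the objective is strictly convex and coercive, so the
  minimizer below is unique.\<close>

definition gfun :: "real^'k^'k \<Rightarrow> real \<Rightarrow> real^'k \<Rightarrow> real^'k" where
  "gfun A lam \<theta> = (ARG_MIN (\<lambda>g. 1/2 * (norm g)\<^sup>2 + lam * penalty A (\<theta> + g)) g. True)"

definition hfun :: "real^'k^'k \<Rightarrow> real \<Rightarrow> real^'k \<Rightarrow> real^'k" where
  "hfun A lam \<theta> = matrix_inv A *v (\<theta> + gfun A lam \<theta>)"

definition eta :: "real^'k^'k \<Rightarrow> real \<Rightarrow> real^'k \<Rightarrow> real^'k" where
  "eta A lam \<theta> = (\<chi> j. sgn (hfun A lam \<theta> $ j))"

definition active :: "real^'k \<Rightarrow> 'k set" where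
  "active e = {j. e $ j \<noteq> 0}"

text \<open>The matrix \<open>A\<^sub>J\<close> is embedded into square matrices by replacing the columns outside \<open>J\<close> by
  zero. Correspondingly \<open>gram_inv A J\<close> has \<open>(A\<^sub>J' A\<^sub>J)\<close> inverse as its \<open>J\<close>-block, is the identity on
  the complementary block and vanishes elsewhere. The complementary block is irrelevant wherever
  \<open>gram_inv A J\<close> meets only \<open>cols A J\<close> or vectors supported on \<open>J\<close>.\<close>

definition cols :: "real^'k^'k \<Rightarrow> 'k set \<Rightarrow> real^'k^'k" where
  "cols A J = (\<chi> i j. if j \<in> J then A $ i $ j else 0)"

definition diag_ind :: "'k set \<Rightarrow> real^'k^'k" where
  "diag_ind J = (\<chi> i j. if i = j \<and> i \<in> J then 1 else 0)"

definition gram_inv :: "real^'k^'k \<Rightarrow> 'k set \<Rightarrow> real^'k^'k" where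
  "gram_inv A J = matrix_inv (transpose (cols A J) ** cols A J + diag_ind (- J))"

definition grad_formula :: "real^'k^'k \<Rightarrow> 'k set \<Rightarrow> real^'k^'k" where
  "grad_formula A J = cols A J ** gram_inv A J ** transpose (cols A J) - mat 1"

lemma diag_ind_mult_vec: "(diag_ind J *v x) $ i = (if i \<in> J then x $ i else 0)"
  by (simp add: diag_ind_def matrix_vector_mult_def if_distrib [of "\<lambda>c. c * _"] sum.If_cases
      cong: if_cong)

lemma cols_mult_vec:
  assumes "\<And>j. j \<notin> J \<Longrightarrow> x $ j = 0"
  shows "cols A J *v x = A *v x"
  unfolding vec_eq_iff cols_def matrix_vector_mult_def
  by (auto intro!: sum.cong simp: assms)

lemma gram_inv_right:
  fixes A :: "real^'k^'k"
  assumes A: "invertible A"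
  shows "(transpose (cols A J) ** cols A J) ** gram_inv A J = diag_ind J"
proof -
  define C where "C = cols A J"
  define D where "D = (diag_ind (- J) :: real^'k^'k)"
  define G where "G = transpose C ** C + D"
  have "x = 0" if "G *v x = 0" for x
  proof -
    have "x \<bullet> (G *v x) = (C *v x) \<bullet> (C *v x) + x \<bullet> (D *v x)"
      by (simp add: G_def matrix_vector_mult_add_rdistrib inner_add_right
          matrix_vector_mul_assoc [symmetric] inner_commute flip: dot_lmul_matrix)
    moreover have xD: "x \<bullet> (D *v x) = (\<Sum>i\<in>UNIV. if i \<in> - J then (x $ i)\<^sup>2 else 0)"
      unfolding inner_vec_def D_def diag_ind_mult_vec
      by (intro sum.cong) (auto simp: power2_eq_square)
    moreover have "x \<bullet> (D *v x) \<ge> 0"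
      unfolding xD by (intro sum_nonneg) auto
    ultimately have C0: "C *v x = 0" and "x \<bullet> (D *v x) = 0"
      using that by (auto simp: add_nonneg_eq_0_iff)
    then have "\<forall>i. (if i \<in> - J then (x $ i)\<^sup>2 else 0) = 0"
      unfolding xD by (subst (asm) sum_nonneg_eq_0_iff) auto
    then have "x $ j = 0" if "j \<notin> J" for j
      using that by (metis ComplI zero_eq_power2)
    then have "A *v x = 0"
      using C0 by (simp add: C_def cols_mult_vec)
    then show "x = 0"
      using A by (metis invertible_def matrix_left_invertible_ker)
  qed
  then have "invertible G"
    by (metis invertible_left_inverse matrix_left_invertible_ker)
  then have inv: "G ** matrix_inv G = mat 1"
    unfolding matrix_inv_def invertible_def by (metis (mono_tags, lifting) someI_ex)
  have "D ** G = D"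
    by (auto simp: G_def C_def D_def cols_def diag_ind_def transpose_def vec_eq_iff
        matrix_matrix_mult_def if_distrib [of "\<lambda>c. c * _"] if_distrib [of "\<lambda>c. _ * c"]
        sum.If_cases intro!: sum.neutral cong: if_cong)
  then have D: "D ** matrix_inv G = D"
    by (metis inv matrix_mul_assoc matrix_mul_rid)
  have "(transpose C ** C) ** matrix_inv G + D ** matrix_inv G = G ** matrix_inv G"
    by (auto simp: G_def vec_eq_iff matrix_matrix_mult_def distrib_right sum.distrib)
  then have "(transpose C ** C) ** matrix_inv G = mat 1 - D"
    using inv D by (metis add_diff_cancel)
  also have "\<dots> = diag_ind J"
    by (auto simp: D_def diag_ind_def mat_def vec_eq_iff)
  finally show ?thesis
    by (simp add: gram_inv_def C_def D_def G_def)
qed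

text \<open>Value of the gradient of \<open>g\<close>. It is the Jacobian wherever \<open>lam > 0\<close> and the derivative exists.
  At the remaining points (\<open>\<theta>\<close> on a boundary between two regions of smoothness, or \<open>lam = 0\<close>) it
  is the closed form belonging to the current sign vector, so that every segment contains those of
  its endpoints at which the sign vector is the same. Putting the gradient to zero at these points
  instead would leave SURE without a minimizer: for \<open>k = 1\<close>, \<open>A = 1\<close>, unit variance and
  \<open>\<theta> = 1\<close>, SURE is \<open>(1 + lam\<^sup>2) / 2\<close> for \<open>lam < 1\<close> and \<open>0\<close> for \<open>lam > 1\<close>, and
  would be \<open>1\<close> at the kink \<open>lam = 1\<close>, so the set of minimizers would have no smallest element.
  At \<open>lam = 0\<close> the derivative is \<open>0\<close>, which is the closed form unless \<open>A\<close> inverse times \<open>\<theta>\<close>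
  has a zero coordinate; in that case with, say, \<open>A = mat 1\<close>, SURE would jump down right after
  \<open>lam = 0\<close> and its infimum could again fail to be attained.\<close>

definition grad_g :: "real^'k^'k \<Rightarrow> real \<Rightarrow> real^'k \<Rightarrow> real^'k^'k" where
  "grad_g A lam \<theta> =
     (if 0 < lam \<and> gfun A lam differentiable (at \<theta>) then jacobian (gfun A lam) (at \<theta>)
      else grad_formula A (active (eta A lam \<theta>)))"

definition SURE :: "real^'k^'k \<Rightarrow> real^'k^'k \<Rightarrow> real \<Rightarrow> real^'k \<Rightarrow> real" where
  "SURE A S lam \<theta> =
     1/2 * (trace S + (norm (gfun A lam \<theta>))\<^sup>2 + 2 * trace (grad_g A lam \<theta> ** S))"

definition SURE_polar :: "real^'k^'k \<Rightarrow> real^'k^'k \<Rightarrow> real \<Rightarrow> real \<Rightarrow> real^'k \<Rightarrow> real" where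
  "SURE_polar A S lam R \<nu> = SURE A S lam (R *\<^sub>R \<nu>)"

definition segment :: "real^'k^'k \<Rightarrow> real^'k \<Rightarrow> real^'k \<Rightarrow> real set" where
  "segment A \<theta> e = {lam. 0 \<le> lam \<and> eta A lam \<theta> = e}"

text \<open>Local minimizers on \<open>{0..}\<close>, where a flat stretch is represented by its left endpoint only
  (ties go to the smallest minimizer). This matters because SURE is constant for all large
  \<open>lam\<close>, where the sign vector is zero.\<close>

definition local_minimizers :: "(real \<Rightarrow> real) \<Rightarrow> real set" where
  "local_minimizers f =
     {x. 0 \<le> x \<and> (\<exists>\<epsilon>>0. \<forall>y\<ge>0. \<bar>y - x\<bar> < \<epsilon> \<longrightarrow> f x \<le> f y \<and> (y < x \<longrightarrow> f x < f y))}"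

definition global_minimizers :: "(real \<Rightarrow> real) \<Rightarrow> real set" where
  "global_minimizers f = {x. 0 \<le> x \<and> (\<forall>y\<ge>0. f x \<le> f y)}"

definition lam_opt :: "real^'k^'k \<Rightarrow> real^'k^'k \<Rightarrow> real \<Rightarrow> real^'k \<Rightarrow> real" where
  "lam_opt A S R \<nu> = (LEAST lam. lam \<in> global_minimizers (\<lambda>l. SURE_polar A S l R \<nu>))"

end

theory Submission
  imports Defs
begin

text \<open>Along the path \<open>lam\<close> enters SURE in two ways. The loss \<open>\<parallel>g\<parallel>\<^sup>2\<close> is continuous and increasing in
  \<open>lam\<close>, strictly so while \<open>\<eta> \<noteq> 0\<close>, because \<open>- g\<close> is the projection of \<open>\<theta>\<close> onto a polytope that
  grows with \<open>lam\<close>. The trace term depends on the active set \<open>J\<close> only, hence takes finitely many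
  values; it is lower semicontinuous because \<open>J\<close> can only grow near a given \<open>lam\<close> and the projection
  onto the span of \<open>A\<^sub>J\<close> is monotone in \<open>J\<close>. In the variable \<open>lam / R\<close>, SURE becomes
  \<open>c + R\<^sup>2 N + T\<close> with such \<open>N\<close> and \<open>T\<close> independent of \<open>R\<close>. Its local minimizers are those of \<open>T\<close>,
  and comparing two values of \<open>R\<close> shows that the smallest global minimizer decreases in \<open>R\<close>.\<close>

section \<open>Optimality conditions\<close>

text \<open>\<open>gfun\<close> is a choice term, so none of its values is computed directly. Each
  one is obtained by exhibiting a vector that satisfies \<open>kkt\<close> and appealing to
  uniqueness; the scaling law, the convexity of the segments and the directional derivatives all
  arise in this way. The obstacle is the gradient. SURE uses the Jacobian where it exists and a
  closed form elsewhere, and the two could disagree at the kinks, which is where the positive local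
  minimizers sit. \<open>jacobian_gfun\<close> shows that for positive \<open>lam\<close> the
  Jacobian, whenever it exists, equals the closed form; only then is the trace term a function of
  the active set without exceptions. The bound \<open>3 ^ CARD('k)\<close> on the number of local
  minimizers comes from an injection into sign vectors: each segment is an interval, and the sign
  vector changes immediately to the left of every positive local minimizer, so no two of them share
  one. The jumps of the optimum in \<open>R\<close> inherit the bound.\<close>

lemma mult_vec_inner:
  fixes A :: "real^'n^'m"
  shows "(A *v x) \<bullet> u = (\<Sum>j\<in>UNIV. x $ j * (column j A \<bullet> u))"
  by (simp add: matrix_mult_sum inner_sum_left scalar_mult_eq_scaleR)

lemma matrix_inv:
  assumes "invertible A"
  shows matrix_inv_right: "A ** matrix_inv A = mat 1"
    and matrix_inv_left: "matrix_inv A ** A = mat 1"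
  using someI_ex[OF assms[unfolded invertible_def]] by (auto simp: matrix_inv_def)

lemma invertible_mult_inv:
  fixes A :: "real^'n^'n"
  assumes "invertible A"
  shows "A *v (matrix_inv A *v x) = x" "matrix_inv A *v (A *v x) = x"
  using assms by (simp_all add: matrix_vector_mul_assoc matrix_inv_left matrix_inv_right)

text \<open>The rows of the inverse are the basis dual to the columns, so adding a multiple of row
  \<open>i\<close> to a vector changes its inner product with column \<open>i\<close> and with no
  other column.\<close>

lemma column_inner_row_inv:
  fixes A :: "real^'n^'n"
  assumes "invertible A"
  shows "column i A \<bullet> row j (matrix_inv A) = (if i = j then 1 else 0)"
proof -
  have "(matrix_inv A ** A) $ j $ i = row j (matrix_inv A) \<bullet> column i A"
    by (simp add: matrix_matrix_mult_def row_def column_def inner_vec_def)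
  then show ?thesis
    by (auto simp: matrix_inv_left[OF assms] mat_def inner_commute split: if_splits)
qed

text \<open>The stationarity condition of the l1-penalized least squares problem: the transpose of
  \<open>A\<close> applied to the residual is \<open>lam\<close> times a subgradient of the l1 norm
  at \<open>h\<close>.\<close>

definition kkt :: "real^'k^'k \<Rightarrow> real \<Rightarrow> real^'k \<Rightarrow> real^'k \<Rightarrow> bool" where
  "kkt A lam \<theta> h \<longleftrightarrow>
     (\<forall>j. \<bar>column j A \<bullet> (\<theta> - A *v h)\<bar> \<le> lam \<and>
          (h $ j \<noteq> 0 \<longrightarrow> column j A \<bullet> (\<theta> - A *v h) = lam * sgn (h $ j)))"

text \<open>Together with the equality at \<open>x = h\<close> in \<open>kkt_inner_eq\<close> this
  is the subgradient inequality. Optimality, \<open>hfun_monotone\<close> and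
  \<open>norm_gfun_gain\<close> all rest on this pair.\<close>

lemma kkt_inner_le:
  assumes "kkt A lam \<theta> h"
  shows "(A *v x) \<bullet> (\<theta> - A *v h) \<le> lam * l1_norm x"
proof -
  have "x $ j * (column j A \<bullet> (\<theta> - A *v h)) \<le> lam * \<bar>x $ j\<bar>" for j
  proof -
    have "x $ j * (column j A \<bullet> (\<theta> - A *v h)) \<le> \<bar>x $ j\<bar> * \<bar>column j A \<bullet> (\<theta> - A *v h)\<bar>"
      by (metis abs_ge_self abs_mult)
    also have "\<dots> \<le> \<bar>x $ j\<bar> * lam"
      using assms by (intro mult_left_mono) (auto simp: kkt_def)
    finally show ?thesis by (simp add: mult.commute)
  qed
  then show ?thesis
    by (simp add: mult_vec_inner l1_norm_def sum_distrib_left sum_mono)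
qed

lemma kkt_inner_eq:
  assumes "kkt A lam \<theta> h"
  shows "(A *v h) \<bullet> (\<theta> - A *v h) = lam * l1_norm h"
  unfolding mult_vec_inner l1_norm_def sum_distrib_left
proof (intro sum.cong refl)
  fix j
  show "h $ j * (column j A \<bullet> (\<theta> - A *v h)) = lam * \<bar>h $ j\<bar>"
    using assms by (cases "h $ j = 0") (auto simp: kkt_def abs_sgn algebra_simps)
qed

text \<open>The residual is the projection of \<open>\<theta>\<close> onto the polytope of all \<open>u\<close> with
  \<open>\<bar>column j A \<bullet> u\<bar> \<le> lam\<close>; the variational inequality of this projection is tested by changing
  one dual coordinate \<open>column j A \<bullet> u\<close> at a time.\<close>

lemma kkt_exists:
  fixes A :: "real^'k^'k"
  assumes A: "invertible A" and lam: "0 \<le> lam"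
  shows "\<exists>h. kkt A lam \<theta> h"
proof -
  define K where "K = {u. \<forall>j. \<bar>column j A \<bullet> u\<bar> \<le> lam}"
  have K: "K = (\<Inter>j. {u. column j A \<bullet> u \<le> lam} \<inter> {u. column j A \<bullet> u \<ge> - lam})"
    unfolding K_def by (auto simp: abs_le_iff minus_le_iff)
  have closed: "closed K"
    unfolding K by (intro closed_INT ballI closed_Int closed_halfspace_le closed_halfspace_ge)
  have convex: "convex K"
    unfolding K by (intro convex_INT convex_Int convex_halfspace_le convex_halfspace_ge)
  have "0 \<in> K" using lam by (simp add: K_def)
  then have ne: "K \<noteq> {}" by auto
  define u where "u = closest_point K \<theta>"
  define h where "h = matrix_inv A *v (\<theta> - u)"
  have Ah: "\<theta> - A *v h = u"
    by (simp add: h_def invertible_mult_inv[OF A])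
  have uK: "u \<in> K" unfolding u_def by (rule closest_point_in_set[OF closed ne])
  have vi: "(\<theta> - u) \<bullet> (v - u) \<le> 0" if "v \<in> K" for v
    unfolding u_def by (rule closest_point_dot[OF convex closed that])
  define B where "B = matrix_inv A"
  have h_row: "h $ i = row i B \<bullet> (\<theta> - u)" for i
    by (simp add: h_def B_def matrix_mult_dot row_def vec_lambda_eta)
  have "column i A \<bullet> u = lam * sgn (h $ i)" if hi: "h $ i \<noteq> 0" for i
  proof -
    \<comment> \<open>This moves dual coordinate \<open>i\<close> to the end of
      \<open>[-lam, lam]\<close> on the side of \<open>h $ i\<close>. Hence \<open>c\<close> cannot
      have the sign opposite to \<open>h $ i\<close>, and \<open>c * h $ i \<le> 0\<close> forces
      \<open>c = 0\<close>.\<close>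
    define c where "c = lam * sgn (h $ i) - column i A \<bullet> u"
    have "column j A \<bullet> (u + c *\<^sub>R row i B) = (if j = i then lam * sgn (h $ i) else column j A \<bullet> u)" for j
      by (simp add: inner_add_right c_def B_def column_inner_row_inv[OF A])
    then have "u + c *\<^sub>R row i B \<in> K"
      using uK lam by (auto simp: K_def abs_mult abs_sgn_eq)
    from vi[OF this] have "c * h $ i \<le> 0"
      by (simp add: h_row inner_commute)
    moreover have "\<bar>column i A \<bullet> u\<bar> \<le> lam" using uK by (simp add: K_def)
    ultimately show ?thesis using hi
      by (cases "h $ i > 0") (auto simp: c_def mult_le_0_iff sgn_if)
  qed
  then have "kkt A lam \<theta> h"
    using uK unfolding kkt_def Ah K_def by auto
  then show ?thesis by blast
qed

text \<open>The objective exceeds its value at the candidate by at least half the squared distance.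
  This surplus yields minimality and uniqueness at once, and uniqueness is what pins down the choice
  term.\<close>

lemma kkt_gfun:
  fixes A :: "real^'k^'k"
  assumes A: "invertible A" and kkt: "kkt A lam \<theta> h"
  shows "gfun A lam \<theta> = A *v h - \<theta>"
proof -
  define obj where "obj = (\<lambda>g. 1/2 * (norm g)\<^sup>2 + lam * penalty A (\<theta> + g))"
  have min: "obj (A *v h - \<theta>) + 1/2 * (norm (g - (A *v h - \<theta>)))\<^sup>2 \<le> obj g" for g
  proof -
    define x where "x = matrix_inv A *v (\<theta> + g)"
    have g: "g = A *v x - \<theta>" by (simp add: x_def invertible_mult_inv[OF A])
    have "(A *v x) \<bullet> (\<theta> - A *v h) - (A *v h) \<bullet> (\<theta> - A *v h) \<le> lam * l1_norm x - lam * l1_norm h"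
      using kkt_inner_le[OF kkt, of x] kkt_inner_eq[OF kkt] by simp
    then have "- ((A *v h - \<theta>) \<bullet> (g - (A *v h - \<theta>))) \<le> lam * l1_norm x - lam * l1_norm h"
      by (simp add: g inner_diff_left inner_diff_right inner_commute)
    moreover have "(norm g)\<^sup>2 = (norm (A *v h - \<theta>))\<^sup>2 + 2 * ((A *v h - \<theta>) \<bullet> (g - (A *v h - \<theta>)))
        + (norm (g - (A *v h - \<theta>)))\<^sup>2"
      unfolding power2_norm_eq_inner by (simp add: inner_diff_left inner_diff_right inner_commute)
    moreover have pen: "penalty A (\<theta> + (A *v h - \<theta>)) = l1_norm h" "penalty A (\<theta> + g) = l1_norm x"
      by (simp_all add: penalty_def x_def invertible_mult_inv[OF A])
    ultimately show ?thesis
      unfolding obj_def pen by linarith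
  qed
  show ?thesis
    unfolding gfun_def arg_min_def
    unfolding obj_def[symmetric]
  proof (rule some_equality)
    show "is_arg_min obj (\<lambda>g. True) (A *v h - \<theta>)"
      using order_trans[OF _ min] by (auto simp: is_arg_min_def not_less)
  next
    fix g assume "is_arg_min obj (\<lambda>g. True) g"
    then have "obj g \<le> obj (A *v h - \<theta>)"
      by (auto simp: is_arg_min_def not_less)
    with min[of g] have "(norm (g - (A *v h - \<theta>)))\<^sup>2 \<le> 0" by linarith
    then show "g = A *v h - \<theta>" by simp
  qed
qed

lemma kkt_hfun_unique:
  assumes "invertible A" "kkt A lam \<theta> h"
  shows "hfun A lam \<theta> = h"
  by (simp add: hfun_def kkt_gfun[OF assms] invertible_mult_inv[OF assms(1)])

lemma kkt_hfun:
  assumes "invertible A" "0 \<le> lam"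
  shows "kkt A lam \<theta> (hfun A lam \<theta>)"
  using kkt_exists[OF assms, of \<theta>] kkt_hfun_unique[OF assms(1)] by metis

lemma gfun_eq:
  assumes "invertible A"
  shows "gfun A lam \<theta> = A *v hfun A lam \<theta> - \<theta>"
  by (simp add: hfun_def invertible_mult_inv[OF assms])

text \<open>Residual and threshold are multiplied by the same positive factor while the signs of
  \<open>h\<close> stay the same.\<close>

lemma kkt_scale:
  assumes "kkt A lam \<theta> h" "0 < r"
  shows "kkt A (r * lam) (r *\<^sub>R \<theta>) (r *\<^sub>R h)"
proof -
  have "r *\<^sub>R \<theta> - A *v (r *\<^sub>R h) = r *\<^sub>R (\<theta> - A *v h)"
    by (simp add: matrix_vector_mult_scaleR algebra_simps)
  then show ?thesis
    using assms by (auto simp: kkt_def abs_mult sgn_mult)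
qed

lemma hfun_scale:
  assumes "invertible A" "0 \<le> lam" "0 < r"
  shows "hfun A (r * lam) (r *\<^sub>R \<theta>) = r *\<^sub>R hfun A lam \<theta>"
  by (intro kkt_hfun_unique kkt_scale kkt_hfun assms)

lemma gfun_scale:
  assumes "invertible A" "0 \<le> lam" "0 < r"
  shows "gfun A (r * lam) (r *\<^sub>R \<theta>) = r *\<^sub>R gfun A lam \<theta>"
  unfolding gfun_eq[OF assms(1)] hfun_scale[OF assms] matrix_vector_mult_scaleR scaleR_diff_right ..

lemma eta_scale:
  assumes "invertible A" "0 \<le> lam" "0 < r"
  shows "eta A (r * lam) (r *\<^sub>R \<theta>) = eta A lam \<theta>"
  using assms by (simp add: eta_def hfun_scale sgn_mult)

section \<open>Dependence on the tuning parameter and on the data\<close>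

text \<open>Each solution is tested in the subgradient inequality of the other, and the results are
  added. Both parameters vary so that one inequality serves twice: \<open>a = b\<close> gives the
  Lipschitz bound in the data, \<open>\<theta> = \<tau>\<close> the dependence on
  \<open>lam\<close>.\<close>

lemma hfun_monotone:
  assumes A: "invertible A" and lam: "0 \<le> a" "0 \<le> b"
  shows "(A *v hfun A a \<theta> - A *v hfun A b \<tau>) \<bullet> ((\<theta> - A *v hfun A a \<theta>) - (\<tau> - A *v hfun A b \<tau>))
    \<ge> (a - b) * (l1_norm (hfun A a \<theta>) - l1_norm (hfun A b \<tau>))"
  using kkt_inner_le[OF kkt_hfun[OF A lam(1)], of "hfun A b \<tau>" \<theta>] kkt_inner_eq[OF kkt_hfun[OF A lam(1)], of \<theta>]
    kkt_inner_le[OF kkt_hfun[OF A lam(2)], of "hfun A a \<theta>" \<tau>] kkt_inner_eq[OF kkt_hfun[OF A lam(2)], of \<tau>]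
  by (simp add: inner_diff_left inner_diff_right algebra_simps)

lemma gfun_dist_le:
  assumes A: "invertible A" and lam: "0 \<le> lam"
  shows "dist (gfun A lam \<theta>) (gfun A lam \<tau>) \<le> dist \<theta> \<tau>"
proof -
  define u v where "u = gfun A lam \<theta>" and "v = gfun A lam \<tau>"
  have "((\<theta> + u) - (\<tau> + v)) \<bullet> (v - u) \<ge> 0"
    using hfun_monotone[OF A lam lam, of \<theta> \<tau>] by (simp add: u_def v_def gfun_eq[OF A] inner_diff_right)
  then have "(norm (u - v))\<^sup>2 \<le> (\<theta> - \<tau>) \<bullet> (v - u)"
    by (simp add: power2_norm_eq_inner inner_diff_left inner_diff_right inner_add_left algebra_simps)
  also have "\<dots> \<le> norm (\<theta> - \<tau>) * norm (u - v)"
    by (metis norm_cauchy_schwarz norm_minus_commute)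
  finally have "norm (u - v) \<le> norm (\<theta> - \<tau>)"
    by (metis (no_types, lifting) mult_right_le_imp_le norm_ge_zero power2_eq_square zero_less_norm_iff norm_zero)
  then show ?thesis by (simp add: dist_norm u_def v_def)
qed

lemma l1_norm_nonneg: "0 \<le> l1_norm x"
  by (simp add: l1_norm_def sum_nonneg)

lemma gfun_param_ineq:
  assumes A: "invertible A" and lam: "0 \<le> a" "0 \<le> b"
  shows "(norm (gfun A a \<theta> - gfun A b \<theta>))\<^sup>2
    \<le> (b - a) * (l1_norm (hfun A a \<theta>) - l1_norm (hfun A b \<theta>))"
proof -
  define u v where "u = gfun A a \<theta>" and "v = gfun A b \<theta>"
  have "((\<theta> + u) - (\<theta> + v)) \<bullet> (v - u) \<ge> (a - b) * (l1_norm (hfun A a \<theta>) - l1_norm (hfun A b \<theta>))"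
    using hfun_monotone[OF A lam, of \<theta> \<theta>] by (simp add: u_def v_def gfun_eq[OF A])
  then show ?thesis unfolding u_def[symmetric] v_def[symmetric]
    by (simp add: power2_norm_eq_inner inner_diff_left inner_diff_right inner_add_left algebra_simps)
qed

lemma l1_norm_hfun_antimono:
  assumes A: "invertible A" and lam: "0 \<le> a" "a \<le> b"
  shows "l1_norm (hfun A b \<theta>) \<le> l1_norm (hfun A a \<theta>)"
proof (cases "a = b")
  case False
  have "0 \<le> (b - a) * (l1_norm (hfun A a \<theta>) - l1_norm (hfun A b \<theta>))"
    by (rule order_trans[OF zero_le_power2 gfun_param_ineq[OF A]]) (use lam in auto)
  then show ?thesis using False lam by (simp add: zero_le_mult_iff)
qed simp

text \<open>All the l1 norms lie between zero and the one at \<open>lam = 0\<close>, so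
  \<open>gfun_param_ineq\<close> gives Hoelder continuity of order one half in
  \<open>lam\<close>.\<close>

lemma gfun_param_dist_le:
  assumes A: "invertible A" and lam: "0 \<le> a" "0 \<le> b"
  shows "(norm (gfun A a \<theta> - gfun A b \<theta>))\<^sup>2 \<le> \<bar>a - b\<bar> * l1_norm (hfun A 0 \<theta>)"
proof -
  have "(norm (gfun A a \<theta> - gfun A b \<theta>))\<^sup>2
      \<le> \<bar>b - a\<bar> * \<bar>l1_norm (hfun A a \<theta>) - l1_norm (hfun A b \<theta>)\<bar>"
    using gfun_param_ineq[OF A lam, of \<theta>] by (metis abs_ge_self abs_mult order_trans)
  also have "\<dots> \<le> \<bar>b - a\<bar> * l1_norm (hfun A 0 \<theta>)"
    using l1_norm_hfun_antimono[OF A, of 0 a \<theta>] l1_norm_hfun_antimono[OF A, of 0 b \<theta>] lam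
      l1_norm_nonneg[of "hfun A a \<theta>"] l1_norm_nonneg[of "hfun A b \<theta>"]
    by (intro mult_left_mono) auto
  finally show ?thesis by (simp add: abs_minus_commute)
qed

lemma continuous_on_gfun_param:
  assumes A: "invertible A"
  shows "continuous_on {0..} (\<lambda>lam. gfun A lam \<theta>)"
  unfolding continuous_on_def
proof
  fix a :: real assume a: "a \<in> {0..}"
  have "((\<lambda>x. sqrt (\<bar>x - a\<bar> * l1_norm (hfun A 0 \<theta>))) \<longlongrightarrow> sqrt (\<bar>a - a\<bar> * l1_norm (hfun A 0 \<theta>))) (at a within {0..})"
    by (intro tendsto_intros)
  then have "((\<lambda>x. sqrt (\<bar>x - a\<bar> * l1_norm (hfun A 0 \<theta>))) \<longlongrightarrow> 0) (at a within {0..})" by simp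
  moreover have "\<forall>\<^sub>F x in at a within {0..}. norm (gfun A x \<theta> - gfun A a \<theta>) \<le> sqrt (\<bar>x - a\<bar> * l1_norm (hfun A 0 \<theta>))"
    unfolding eventually_at_filter
    using a by (auto intro!: always_eventually real_le_rsqrt gfun_param_dist_le[OF A])
  ultimately have "((\<lambda>x. gfun A x \<theta> - gfun A a \<theta>) \<longlongrightarrow> 0) (at a within {0..})"
    by (rule Lim_null_comparison[rotated])
  then show "((\<lambda>x. gfun A x \<theta>) \<longlongrightarrow> gfun A a \<theta>) (at a within {0..})"
    by (simp add: LIM_zero_iff)
qed

text \<open>The condition at \<open>a\<close>, tested with the solution for \<open>b\<close>, and
  the decrease of the l1 norm along the path give the increment of \<open>gfun\<close> a nonnegative
  inner product with \<open>gfun A a \<theta>\<close>. The squared increment is kept because it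
  identifies the two solutions in the case of equality.\<close>

lemma norm_gfun_gain:
  assumes A: "invertible A" and lam: "0 \<le> a" "a \<le> b"
  shows "(norm (gfun A a \<theta>))\<^sup>2 + (norm (gfun A b \<theta> - gfun A a \<theta>))\<^sup>2 \<le> (norm (gfun A b \<theta>))\<^sup>2"
proof -
  define h k where "h = hfun A a \<theta>" and "k = hfun A b \<theta>"
  define u v where "u = gfun A a \<theta>" and "v = gfun A b \<theta>"
  have u: "u = A *v h - \<theta>" and v: "v = A *v k - \<theta>"
    by (simp_all add: u_def v_def h_def k_def gfun_eq[OF A])
  have "(A *v k) \<bullet> (\<theta> - A *v h) \<le> a * l1_norm k" "(A *v h) \<bullet> (\<theta> - A *v h) = a * l1_norm h"
    using kkt_inner_le[OF kkt_hfun[OF A lam(1)]] kkt_inner_eq[OF kkt_hfun[OF A lam(1)]]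
    by (auto simp: h_def)
  moreover have "a * l1_norm k \<le> a * l1_norm h"
    using l1_norm_hfun_antimono[OF A lam] lam by (simp add: h_def k_def mult_left_mono)
  ultimately have "0 \<le> u \<bullet> (v - u)"
    unfolding u v by (simp add: inner_diff_left inner_diff_right inner_commute)
  then show ?thesis
    unfolding u_def[symmetric] v_def[symmetric] power2_norm_eq_inner
    by (simp add: inner_diff_left inner_diff_right inner_commute)
qed

lemma norm_gfun_mono:
  assumes "invertible A" "0 \<le> a" "a \<le> b"
  shows "(norm (gfun A a \<theta>))\<^sup>2 \<le> (norm (gfun A b \<theta>))\<^sup>2"
  by (rule order_trans[OF _ norm_gfun_gain[OF assms]]) simp

lemma norm_gfun_strict_mono:
  assumes A: "invertible A" and lam: "0 \<le> a" "a < b" and nz: "eta A a \<theta> \<noteq> 0"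
  shows "(norm (gfun A a \<theta>))\<^sup>2 < (norm (gfun A b \<theta>))\<^sup>2"
proof (rule ccontr)
  assume "\<not> ?thesis"
  with norm_gfun_gain[OF A lam(1), of b \<theta>] lam have "(norm (gfun A b \<theta> - gfun A a \<theta>))\<^sup>2 \<le> 0" by linarith
  then have eq: "hfun A b \<theta> = hfun A a \<theta>" by (simp add: hfun_def)
  obtain j where j: "hfun A a \<theta> $ j \<noteq> 0"
    using nz by (auto simp: eta_def vec_eq_iff sgn_eq_0_iff)
  \<comment> \<open>At an active coordinate the residual determines \<open>lam\<close>, so two
    different parameters cannot share a solution that is not zero.\<close>
  have "a * sgn (hfun A a \<theta> $ j) = b * sgn (hfun A a \<theta> $ j)"
    using kkt_hfun[OF A, of a \<theta>] kkt_hfun[OF A, of b \<theta>] lam j by (auto simp: kkt_def eq)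
  then show False using j lam by (simp add: sgn_eq_0_iff)
qed

section \<open>Increasing cost plus a step function\<close>

lemma closed_bdd_below_least:
  fixes W :: "real set"
  assumes "closed W" "W \<noteq> {}" "W \<subseteq> {0..}"
  obtains x where "x \<in> W" "\<And>y. y \<in> W \<Longrightarrow> x \<le> y"
proof -
  have "bdd_below W" using assms(3) by (meson atLeast_iff bdd_belowI subsetD)
  then show thesis
    using that closed_contains_Inf[OF assms(2) _ assms(1)] cInf_lower by blast
qed

lemma local_minimizers_subset:
  assumes near: "\<And>x. 0 \<le> x \<Longrightarrow> \<exists>r>0. \<forall>y\<ge>0. \<bar>y - x\<bar> < r \<longrightarrow>
    f x \<le> f y \<and> (y < x \<longrightarrow> f x < f y) \<longrightarrow> g x \<le> g y \<and> (y < x \<longrightarrow> g x < g y)"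
  shows "local_minimizers f \<subseteq> local_minimizers g"
proof
  fix x assume "x \<in> local_minimizers f"
  then obtain e where x: "0 \<le> x" and e: "e > 0"
    "\<forall>y\<ge>0. \<bar>y - x\<bar> < e \<longrightarrow> f x \<le> f y \<and> (y < x \<longrightarrow> f x < f y)"
    unfolding local_minimizers_def by blast
  obtain r where r: "r > 0" "\<forall>y\<ge>0. \<bar>y - x\<bar> < r \<longrightarrow>
    f x \<le> f y \<and> (y < x \<longrightarrow> f x < f y) \<longrightarrow> g x \<le> g y \<and> (y < x \<longrightarrow> g x < g y)"
    using near[OF x] by blast
  have "\<forall>y\<ge>0. \<bar>y - x\<bar> < min e r \<longrightarrow> g x \<le> g y \<and> (y < x \<longrightarrow> g x < g y)"
    using e(2) r(2) unfolding min_less_iff_conj by blast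
  moreover have "min e r > 0" using e(1) r(1) by simp
  ultimately show "x \<in> local_minimizers g"
    using x unfolding local_minimizers_def by blast
qed

text \<open>Separates the one-dimensional argument from the matrices. Lower semicontinuity of
  \<open>T\<close> makes its sublevel sets closed, so minima are attained in spite of the jumps; the
  finite range leaves a least jump size; continuity of \<open>N\<close> keeps the variation of
  \<open>R\<^sup>2 * N\<close> below that size locally.\<close>

locale step_cost =
  fixes c :: real and N T :: "real \<Rightarrow> real"
  assumes N_mono: "0 \<le> x \<Longrightarrow> x \<le> y \<Longrightarrow> N x \<le> N y"
    and N_cont: "continuous_on {0..} N"
    and T_finite: "finite (T ` {0..})"
    and T_lsc: "0 \<le> x \<Longrightarrow> \<exists>d>0. \<forall>y\<ge>0. \<bar>y - x\<bar> < d \<longrightarrow> T x \<le> T y"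
begin

definition cost :: "real \<Rightarrow> real \<Rightarrow> real" where
  "cost R x = c + R\<^sup>2 * N x + T x"

text \<open>The set \<open>W\<close> is a parameter because well-separation minimizes over the
  points at distance at least \<open>e\<close> from the optimum, not over the whole
  half-line.\<close>

lemma closed_sublevel:
  assumes W: "closed W" "W \<subseteq> {0..}"
  shows "closed {y\<in>W. T y \<le> t}"
  unfolding closure_subset_eq[symmetric]
proof
  fix x assume x: "x \<in> closure {y\<in>W. T y \<le> t}"
  have "closure {y\<in>W. T y \<le> t} \<subseteq> W"
    by (rule closure_minimal) (use W in auto)
  with x have "x \<in> W" by blast
  with W have "0 \<le> x" by auto
  then obtain d where d: "d > 0" "\<forall>y\<ge>0. \<bar>y - x\<bar> < d \<longrightarrow> T x \<le> T y"
    using T_lsc by blast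
  obtain y where "y \<in> W" "T y \<le> t" "dist y x < d"
    using x d(1) unfolding closure_approachable by blast
  with d W have "T x \<le> t" by (force simp: dist_real_def)
  with \<open>x \<in> W\<close> show "x \<in> {y\<in>W. T y \<le> t}" by simp
qed

text \<open>Since \<open>N\<close> increases, only the least point of each of the finitely many closed sublevel sets
  of \<open>T\<close> competes for the minimum.\<close>

lemma least_minimizer_on:
  assumes W: "closed W" "W \<subseteq> {0..}" "W \<noteq> {}"
  obtains x where "x \<in> W" "\<And>y. y \<in> W \<Longrightarrow> cost R x \<le> cost R y"
    "\<And>y. y \<in> W \<Longrightarrow> y < x \<Longrightarrow> cost R x < cost R y"
proof -
  have "\<exists>x\<in>W. T x \<le> T w \<and> (\<forall>y\<in>W. T y \<le> T w \<longrightarrow> x \<le> y)" if "w \<in> W" for w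
  proof (rule closed_bdd_below_least)
    show "closed {y \<in> W. T y \<le> T w}" by (rule closed_sublevel[OF W(1,2)])
    show "{y \<in> W. T y \<le> T w} \<noteq> {}" using that by auto
    show "{y \<in> W. T y \<le> T w} \<subseteq> {0..}" using W(2) by auto
  qed auto
  then have "\<forall>t\<in>T ` W. \<exists>x\<in>W. T x \<le> t \<and> (\<forall>y\<in>W. T y \<le> t \<longrightarrow> x \<le> y)"
    by blast
  then obtain p where p: "\<And>t. t \<in> T ` W \<Longrightarrow> p t \<in> W \<and> T (p t) \<le> t \<and> (\<forall>y\<in>W. T y \<le> t \<longrightarrow> p t \<le> y)"
    by metis
  define C where "C = p ` T ` W"
  have "finite (T ` W)"
    using T_finite W(2) by (meson finite_subset image_mono)
  then have C: "finite C" "C \<noteq> {}" "C \<subseteq> W"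
    using W(3) p by (auto simp: C_def)
  have better: "\<exists>x\<in>C. x \<le> y \<and> cost R x \<le> cost R y" if y: "y \<in> W" for y
  proof
    show "p (T y) \<in> C" using y by (auto simp: C_def)
    have *: "T (p (T y)) \<le> T y" "p (T y) \<le> y" "0 \<le> p (T y)"
      using p[of "T y"] y W(2) by auto
    then show "p (T y) \<le> y \<and> cost R (p (T y)) \<le> cost R y"
      using N_mono[of "p (T y)" y] by (auto simp: cost_def intro!: add_mono mult_left_mono)
  qed
  define mu where "mu = Min (cost R ` C)"
  \<comment> \<open>Among the best candidates the leftmost is taken. A point further left doing
    equally well would itself be matched by a candidate at or left of it, which is what makes the
    inequality strict on the left.\<close>
  define M where "M = {x\<in>C. cost R x = mu}"
  have "mu \<in> cost R ` C" unfolding mu_def by (rule Min_in) (use C in auto)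
  then have M: "finite M" "M \<noteq> {}" using C by (auto simp: M_def)
  have x: "Min M \<in> C" "cost R (Min M) = mu" using Min_in[OF M] by (auto simp: M_def)
  have mu: "mu \<le> cost R y" if "y \<in> C" for y
    unfolding mu_def using C that by auto
  show thesis
  proof (rule that[of "Min M"])
    show "Min M \<in> W" using x C by auto
    show le: "cost R (Min M) \<le> cost R y" if "y \<in> W" for y
      using better[OF that] mu x by force
    show "cost R (Min M) < cost R y" if y: "y \<in> W" and less: "y < Min M" for y
    proof (rule ccontr)
      assume "\<not> ?thesis"
      with x have *: "cost R y \<le> mu" by simp
      obtain z where z: "z \<in> C" "z \<le> y" "cost R z \<le> cost R y" using better[OF y] by blast
      with * mu have "z \<in> M" by (force simp: M_def)
      then have "Min M \<le> z" using M by simp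
      with z less show False by simp
    qed
  qed
qed

definition opt :: "real \<Rightarrow> real" where
  "opt R = (LEAST x. x \<in> global_minimizers (cost R))"

lemma
  shows opt_nonneg: "0 \<le> opt R"
    and opt_le: "0 \<le> y \<Longrightarrow> cost R (opt R) \<le> cost R y"
    and opt_less: "0 \<le> y \<Longrightarrow> y < opt R \<Longrightarrow> cost R (opt R) < cost R y"
proof -
  obtain x where x: "0 \<le> x" "\<And>y. 0 \<le> y \<Longrightarrow> cost R x \<le> cost R y"
    "\<And>y. 0 \<le> y \<Longrightarrow> y < x \<Longrightarrow> cost R x < cost R y"
    using least_minimizer_on[of "{0..}" R] by auto
  have "opt R = x"
    unfolding opt_def
  proof (rule Least_equality)
    show "x \<in> global_minimizers (cost R)" using x by (simp add: global_minimizers_def)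
    fix y assume "y \<in> global_minimizers (cost R)"
    then have "0 \<le> y" "cost R y \<le> cost R x" using x by (auto simp: global_minimizers_def)
    then show "x \<le> y" using x(3)[of y] by linarith
  qed
  with x show "0 \<le> opt R" "0 \<le> y \<Longrightarrow> cost R (opt R) \<le> cost R y"
    "0 \<le> y \<Longrightarrow> y < opt R \<Longrightarrow> cost R (opt R) < cost R y" for y
    by auto
qed

lemma opt_global_minimizer: "opt R \<in> global_minimizers (cost R)"
  by (simp add: global_minimizers_def opt_nonneg opt_le)

lemma opt_least: "x \<in> global_minimizers (cost R) \<Longrightarrow> opt R \<le> x"
proof (rule ccontr)
  assume x: "x \<in> global_minimizers (cost R)" and "\<not> opt R \<le> x"
  then have "cost R (opt R) < cost R x"
    by (intro opt_less) (auto simp: global_minimizers_def)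
  with x show False using opt_nonneg[of R] by (auto simp: global_minimizers_def not_le[symmetric])
qed

lemma opt_local_minimizer: "opt R \<in> local_minimizers (cost R)"
proof -
  have "\<forall>y\<ge>0. \<bar>y - opt R\<bar> < 1 \<longrightarrow> cost R (opt R) \<le> cost R y \<and> (y < opt R \<longrightarrow> cost R (opt R) < cost R y)"
    by (simp add: opt_le opt_less)
  then show ?thesis
    unfolding local_minimizers_def using opt_nonneg zero_less_one by blast
qed

text \<open>An exchange argument: adding the optimality of \<open>opt R\<close> at \<open>R\<close>
  and of \<open>opt R'\<close> at \<open>R'\<close> cancels \<open>T\<close>. What remains says that
  \<open>N\<close> gains less when weighted with the larger factor, which is impossible for
  increasing \<open>N\<close> if \<open>opt R < opt R'\<close>.\<close>

lemma opt_antimono: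
  assumes "0 < R" "R \<le> R'"
  shows "opt R' \<le> opt R"
proof (rule ccontr)
  assume "\<not> ?thesis"
  then have less: "opt R < opt R'" by simp
  have "cost R (opt R) \<le> cost R (opt R')" "cost R' (opt R') < cost R' (opt R)"
    using opt_le opt_less less opt_nonneg by auto
  then have "R\<^sup>2 * N (opt R) - R\<^sup>2 * N (opt R') < R'\<^sup>2 * N (opt R) - R'\<^sup>2 * N (opt R')"
    by (simp add: cost_def)
  then have "R'\<^sup>2 * (N (opt R') - N (opt R)) < R\<^sup>2 * (N (opt R') - N (opt R))"
    by (simp add: algebra_simps)
  moreover have "R\<^sup>2 * (N (opt R') - N (opt R)) \<le> R'\<^sup>2 * (N (opt R') - N (opt R))"
    using assms N_mono[OF opt_nonneg, of R "opt R'"] less by (intro mult_right_mono power_mono) auto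
  ultimately show False by simp
qed

lemma T_gap: "\<exists>d>0. \<forall>x\<ge>0. \<forall>y\<ge>0. T x < T y \<longrightarrow> T x + d \<le> T y"
proof -
  define G where "G = {b - a |a b. a \<in> T ` {0..} \<and> b \<in> T ` {0..} \<and> a < b}"
  have "G \<subseteq> (\<lambda>(a, b). b - a) ` (T ` {0..} \<times> T ` {0..})"
    by (auto simp: G_def)
  then have "finite G" by (rule finite_subset[OF _ finite_imageI[OF finite_cartesian_product[OF T_finite T_finite]]])
  then have "\<exists>d>0. \<forall>g\<in>G. d \<le> g"
  proof (cases "G = {}")
    case True then show ?thesis by (auto intro: exI[of _ 1])
  next
    case False
    with \<open>finite G\<close> have "Min G \<in> G" by simp
    then have "Min G > 0" by (auto simp: G_def)
    with \<open>finite G\<close> show ?thesis by (auto intro: exI[of _ "Min G"])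
  qed
  then obtain d where d: "d > 0" "\<And>g. g \<in> G \<Longrightarrow> d \<le> g" by blast
  have "T x + d \<le> T y" if "0 \<le> x" "0 \<le> y" "T x < T y" for x y
    using d(2)[of "T y - T x"] that by (force simp: G_def)
  with d(1) show ?thesis by blast
qed

text \<open>Locally the continuous part \<open>R\<^sup>2 N\<close> varies by less than any jump of \<open>T\<close>, so the
  position of the local minimizers is decided by \<open>T\<close> and the monotonicity of \<open>N\<close>, whatever \<open>R\<close>.\<close>

lemma local_minimizers_cost: "local_minimizers (cost R) = local_minimizers T"
proof -
  obtain d where d: "d > 0" "\<And>x y. 0 \<le> x \<Longrightarrow> 0 \<le> y \<Longrightarrow> T x < T y \<Longrightarrow> T x + d \<le> T y"
    using T_gap by blast
  have near: "\<exists>r>0. \<forall>y\<ge>0. \<bar>y - x\<bar> < r \<longrightarrow>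
      (cost R x \<le> cost R y \<and> (y < x \<longrightarrow> cost R x < cost R y) \<longleftrightarrow> T x \<le> T y \<and> (y < x \<longrightarrow> T x < T y))"
    if x: "0 \<le> x" for x
  proof -
    have "continuous_on {0..} (\<lambda>y. R\<^sup>2 * N y)"
      by (intro continuous_intros N_cont)
    then obtain r where r: "r > 0" "\<And>y. 0 \<le> y \<Longrightarrow> \<bar>y - x\<bar> < r \<Longrightarrow> \<bar>R\<^sup>2 * N y - R\<^sup>2 * N x\<bar> < d"
      using x d(1) unfolding continuous_on_iff dist_real_def by (metis atLeast_iff)
    have "cost R x \<le> cost R y \<and> (y < x \<longrightarrow> cost R x < cost R y) \<longleftrightarrow> T x \<le> T y \<and> (y < x \<longrightarrow> T x < T y)"
      if y: "0 \<le> y" "\<bar>y - x\<bar> < r" for y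
    proof -
      have "R\<^sup>2 * N y \<le> R\<^sup>2 * N x" if "y \<le> x"
        using N_mono[of y x] that y by (intro mult_left_mono) auto
      moreover have "R\<^sup>2 * N x \<le> R\<^sup>2 * N y" if "x \<le> y"
        using N_mono[of x y] that x by (intro mult_left_mono) auto
      ultimately show ?thesis
        using r(2)[OF y] d(2)[of x y] d(2)[of y x] x y d(1) unfolding cost_def by linarith
    qed
    with r(1) show ?thesis by blast
  qed
  show ?thesis
  proof (intro antisym local_minimizers_subset)
    fix x :: real assume "0 \<le> x"
    from near[OF this] obtain r where r: "r > 0" "\<And>y. 0 \<le> y \<Longrightarrow> \<bar>y - x\<bar> < r \<Longrightarrow>
      (cost R x \<le> cost R y \<and> (y < x \<longrightarrow> cost R x < cost R y) \<longleftrightarrow> T x \<le> T y \<and> (y < x \<longrightarrow> T x < T y))"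
      by blast
    show "\<exists>r>0. \<forall>y\<ge>0. \<bar>y - x\<bar> < r \<longrightarrow>
      cost R x \<le> cost R y \<and> (y < x \<longrightarrow> cost R x < cost R y) \<longrightarrow> T x \<le> T y \<and> (y < x \<longrightarrow> T x < T y)"
      by (intro exI[of _ r] conjI[OF r(1)] allI impI) (use r(2) in blast)
    show "\<exists>r>0. \<forall>y\<ge>0. \<bar>y - x\<bar> < r \<longrightarrow>
      T x \<le> T y \<and> (y < x \<longrightarrow> T x < T y) \<longrightarrow> cost R x \<le> cost R y \<and> (y < x \<longrightarrow> cost R x < cost R y)"
      by (intro exI[of _ r] conjI[OF r(1)] allI impI) (use r(2) in blast)
  qed
qed

text \<open>A second minimizer \<open>y > opt R\<close> would have larger \<open>N\<close>, hence would beat \<open>opt R\<close> for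
  every smaller \<open>R'\<close>.\<close>

lemma well_separated:
  assumes R: "0 < R'" "R' < R" "opt R' = opt R"
    and strict: "\<And>y. opt R < y \<Longrightarrow> N (opt R) < N y"
    and e: "0 < e"
  shows "\<exists>d>0. \<forall>y\<ge>0. e \<le> \<bar>y - opt R\<bar> \<longrightarrow> cost R (opt R) + d \<le> cost R y"
proof -
  \<comment> \<open>\<open>W\<close> is closed and nonempty, so the cost attains its minimum on it.
    A strict inequality at this one point is then already a uniform gap.\<close>
  define W where "W = {y. 0 \<le> y \<and> e \<le> \<bar>y - opt R\<bar>}"
  have "W = {0..} \<inter> ({.. opt R - e} \<union> {opt R + e ..})"
    using e by (auto simp: W_def)
  then have "closed W" by (auto intro!: closed_Int closed_Un)
  moreover have "W \<subseteq> {0..}" by (auto simp: W_def)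
  moreover have "opt R + e \<in> W" using e opt_nonneg[of R] by (auto simp: W_def)
  ultimately obtain x where x: "x \<in> W" "\<And>y. y \<in> W \<Longrightarrow> cost R x \<le> cost R y"
    using least_minimizer_on[of W R] by (metis empty_iff)
  have "cost R (opt R) < cost R x"
  proof (rule ccontr)
    assume "\<not> ?thesis"
    moreover have "0 \<le> x" "x \<noteq> opt R" using x(1) e by (auto simp: W_def)
    ultimately have eq: "cost R x = cost R (opt R)" and "opt R < x"
      using opt_le[of x R] opt_less[of x R] by fastforce+
    then have "N (opt R) < N x" using strict by blast
    moreover have "R'\<^sup>2 < R\<^sup>2" using R by (simp add: power_strict_mono)
    ultimately have "R'\<^sup>2 * (N x - N (opt R)) < R\<^sup>2 * (N x - N (opt R))" by simp
    then have "cost R' x < cost R' (opt R)"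
      using eq by (simp add: cost_def algebra_simps)
    then show False using opt_le[of x R'] \<open>0 \<le> x\<close> R(3) by simp
  qed
  then show ?thesis
    using x(2) by (intro exI[of _ "cost R x - cost R (opt R)"]) (auto simp: W_def)
qed

end

section \<open>Jumps of the identity times a decreasing step function\<close>

lemma antimono_finite_left_value:
  fixes p :: "real \<Rightarrow> real"
  assumes anti: "antimono_on {0<..} p" and fin: "finite (p ` {0<..})" and R: "0 < R"
  shows "\<exists>v\<in>p ` {0<..}. (\<forall>r. 0 < r \<longrightarrow> r < R \<longrightarrow> v \<le> p r) \<and> (\<forall>\<^sub>F r in at_left R. p r = v)"
proof -
  have fin': "finite (p ` {0<..<R})" by (rule finite_subset[OF _ fin]) auto
  \<comment> \<open>The left limit is the least value on \<open>{0<..<R}\<close>: once a decreasing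
    function has attained it, it stays there up to \<open>R\<close>.\<close>
  have "p ` {0<..<R} \<noteq> {}" using R by simp
  from Min_in[OF fin' this] obtain r0 where r0: "0 < r0" "r0 < R" "p r0 = Min (p ` {0<..<R})"
    by auto
  have min: "p r0 \<le> p r" if "0 < r" "r < R" for r
    using that fin' by (simp add: r0)
  have "\<forall>\<^sub>F r in at_left R. r0 < r \<and> r < R"
    using r0 by (simp add: eventually_at_left_field) (meson)
  then have "\<forall>\<^sub>F r in at_left R. p r = p r0"
  proof (rule eventually_mono)
    fix r assume r: "r0 < r \<and> r < R"
    then have "p r \<le> p r0" using r0 by (intro monotone_onD[OF anti]) auto
    with min r r0 show "p r = p r0" by (auto intro: antisym)
  qed
  moreover have "p r0 \<in> p ` {0<..}" using r0(1) by (intro imageI) simp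
  ultimately show ?thesis using min by blast
qed

lemma antimono_finite_right_value:
  fixes p :: "real \<Rightarrow> real"
  assumes anti: "antimono_on {0<..} p" and fin: "finite (p ` {0<..})" and R: "0 < R"
  shows "\<exists>v\<in>p ` {0<..}. (\<forall>r>R. p r \<le> v) \<and> (\<forall>\<^sub>F r in at_right R. p r = v)"
proof -
  have fin': "finite (p ` {R<..})" by (rule finite_subset[OF _ fin]) (use R in auto)
  have "p ` {R<..} \<noteq> {}" by simp
  from Max_in[OF fin' this] obtain r0 where r0: "R < r0" "p r0 = Max (p ` {R<..})"
    by auto
  have max: "p r \<le> p r0" if "R < r" for r
    using that fin' by (simp add: r0)
  have "\<forall>\<^sub>F r in at_right R. R < r \<and> r < r0"
    using r0 by (simp add: eventually_at_right_field) (meson)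
  then have "\<forall>\<^sub>F r in at_right R. p r = p r0"
  proof (rule eventually_mono)
    fix r assume r: "R < r \<and> r < r0"
    then have "p r0 \<le> p r" using R by (intro monotone_onD[OF anti]) auto
    with max r show "p r = p r0" by (auto intro: antisym)
  qed
  moreover have "p r0 \<in> p ` {0<..}" using R r0(1) by (intro imageI) simp
  ultimately show ?thesis using max by blast
qed

text \<open>For positive \<open>R\<close>, \<open>f\<close> jumps exactly where \<open>p\<close>
  does, that is where the left limit of \<open>p\<close> exceeds the right one. Different jumps have
  different right limits, so there are no more jumps than values. The last claim later supplies a
  smaller radius with the same rescaled minimizer.\<close>

lemma sawtooth:
  fixes p f :: "real \<Rightarrow> real"
  assumes anti: "antimono_on {0<..} p" and fin: "finite (p ` {0<..})"
    and f: "\<And>R. 0 < R \<Longrightarrow> f R = R * p R"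
  defines "D \<equiv> {R. 0 < R \<and> \<not> isCont f R}"
  shows "finite D" "card D \<le> card (p ` {0<..})"
    and "R \<in> D \<Longrightarrow> \<exists>a b. b < a \<and> (f \<longlongrightarrow> a) (at_left R) \<and> (f \<longlongrightarrow> b) (at_right R)"
    and "0 < R \<Longrightarrow> isCont f R \<Longrightarrow> \<forall>\<^sub>F r in nhds R. p r = p R"
proof -
  obtain vl where vl: "\<And>R. 0 < R \<Longrightarrow> vl R \<in> p ` {0<..}"
    "\<And>R r. 0 < R \<Longrightarrow> 0 < r \<Longrightarrow> r < R \<Longrightarrow> vl R \<le> p r" "\<And>R. 0 < R \<Longrightarrow> \<forall>\<^sub>F r in at_left R. p r = vl R"
  proof -
    define P where "P R v \<longleftrightarrow> v \<in> p ` {0<..} \<and> (\<forall>r. 0 < r \<longrightarrow> r < R \<longrightarrow> v \<le> p r) \<and> (\<forall>\<^sub>F r in at_left R. p r = v)" for R v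
    have "\<exists>v. P R v" if "0 < R" for R
      unfolding P_def using antimono_finite_left_value[OF anti fin that] by (simp add: Bex_def)
    then obtain vl where "\<And>R. 0 < R \<Longrightarrow> P R (vl R)" by metis
    then show thesis using that[of vl] by (simp add: P_def)
  qed
  obtain vr where vr: "\<And>R. 0 < R \<Longrightarrow> vr R \<in> p ` {0<..}"
    "\<And>R r. 0 < R \<Longrightarrow> R < r \<Longrightarrow> p r \<le> vr R" "\<And>R. 0 < R \<Longrightarrow> \<forall>\<^sub>F r in at_right R. p r = vr R"
  proof -
    define P where "P R v \<longleftrightarrow> v \<in> p ` {0<..} \<and> (\<forall>r>R. p r \<le> v) \<and> (\<forall>\<^sub>F r in at_right R. p r = v)" for R v
    have "\<exists>v. P R v" if "0 < R" for R
      unfolding P_def using antimono_finite_right_value[OF anti fin that] by (simp add: Bex_def)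
    then obtain vr where "\<And>R. 0 < R \<Longrightarrow> P R (vr R)" by metis
    then show thesis using that[of vr] by (simp add: P_def)
  qed
  have ev: "\<exists>r. 0 < r \<and> r < R \<and> p r = vl R" "\<exists>r. R < r \<and> p r = vr R" if R: "0 < R" for R
  proof -
    have "\<forall>\<^sub>F r in at_left R. 0 < r \<and> r < R"
      using R by (simp add: eventually_at_left_field) (meson)
    from eventually_happens[OF eventually_conj[OF this vl(3)[OF R]]]
    show "\<exists>r. 0 < r \<and> r < R \<and> p r = vl R" by auto
    have "\<forall>\<^sub>F r in at_right R. R < r"
      by (simp add: eventually_at_right_less)
    from eventually_happens[OF eventually_conj[OF this vr(3)[OF R]]]
    show "\<exists>r. R < r \<and> p r = vr R" by auto
  qed
  \<comment> \<open>The one-sided limits are attained at points on either side of \<open>R\<close>,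
    so monotonicity places \<open>p R\<close> between them.\<close>
  have sandwich: "vr R \<le> p R" "p R \<le> vl R" if R: "0 < R" for R
  proof -
    from ev[OF R] obtain r s where "0 < r" "r < R" "p r = vl R" "R < s" "p s = vr R" by blast
    then show "vr R \<le> p R" "p R \<le> vl R"
      using monotone_onD[OF anti, of R s] monotone_onD[OF anti, of r R] R by auto
  qed
  have lim_left: "(f \<longlongrightarrow> R * vl R) (at_left R)" if R: "0 < R" for R
  proof (rule Lim_transform_eventually)
    show "((\<lambda>r. r * vl R) \<longlongrightarrow> R * vl R) (at_left R)" by (intro tendsto_intros)
    have "\<forall>\<^sub>F r in at_left R. 0 < r"
      using R by (simp add: eventually_at_left_field) (meson)
    with vl(3)[OF R] show "\<forall>\<^sub>F r in at_left R. r * vl R = f r"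
      by eventually_elim (simp add: f)
  qed
  have lim_right: "(f \<longlongrightarrow> R * vr R) (at_right R)" if R: "0 < R" for R
  proof (rule Lim_transform_eventually)
    show "((\<lambda>r. r * vr R) \<longlongrightarrow> R * vr R) (at_right R)" by (intro tendsto_intros)
    have "\<forall>\<^sub>F r in at_right R. R < r"
      by (simp add: eventually_at_right_less)
    with vr(3)[OF R] show "\<forall>\<^sub>F r in at_right R. r * vr R = f r"
      by eventually_elim (use R in \<open>simp add: f\<close>)
  qed
  have const: "\<forall>\<^sub>F r in nhds R. p r = p R" if R: "0 < R" and eq: "vl R = vr R" for R
  proof -
    have "vl R = p R" "vr R = p R" using sandwich[OF R] eq by auto
    with vl(3)[OF R] vr(3)[OF R] have "\<forall>\<^sub>F r in at R. p r = p R"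
      by (simp add: eventually_at_split)
    then have "\<forall>\<^sub>F r in nhds R. r \<noteq> R \<longrightarrow> p r = p R" by (simp add: eventually_at_filter)
    then show ?thesis by (rule eventually_mono) auto
  qed
  have D_eq: "D = {R. 0 < R \<and> vr R < vl R}"
  proof (intro set_eqI iffI)
    fix R assume "R \<in> D"
    then have R: "0 < R" "\<not> isCont f R" by (auto simp: D_def)
    have "vl R \<noteq> vr R"
    proof
      assume eq: "vl R = vr R"
      then have "f R = R * vl R" "f R = R * vr R" using sandwich[OF R(1)] R f by auto
      with lim_left[OF R(1)] lim_right[OF R(1)] have "(f \<longlongrightarrow> f R) (at R)"
        by (metis filterlim_at_split)
      with R show False by (simp add: isCont_def)
    qed
    with sandwich[OF R(1)] R show "R \<in> {R. 0 < R \<and> vr R < vl R}" by simp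
  next
    fix R assume "R \<in> {R. 0 < R \<and> vr R < vl R}"
    then have R: "0 < R" "vr R < vl R" by auto
    have "\<not> isCont f R"
    proof
      assume "isCont f R"
      then have "(f \<longlongrightarrow> f R) (at_left R)" "(f \<longlongrightarrow> f R) (at_right R)"
        by (simp_all add: isCont_def filterlim_at_split)
      then have "R * vl R = f R" "R * vr R = f R"
        using tendsto_unique[OF trivial_limit_at_left_real lim_left[OF R(1)]]
          tendsto_unique[OF trivial_limit_at_right_real lim_right[OF R(1)]] by auto
      with mult_strict_left_mono[OF R(2,1)] show False by simp
    qed
    with R show "R \<in> D" by (simp add: D_def)
  qed
  \<comment> \<open>For jumps \<open>r < s\<close> any point \<open>t\<close> between them gives
    \<open>vr s < vl s \<le> p t \<le> vr r\<close>.\<close>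
  have decr: "vr s < vr r" if "r \<in> D" "s \<in> D" "r < s" for r s
  proof -
    define t where "t = (r + s) / 2"
    have *: "r < t" "t < s" "0 < r" "0 < t" "0 < s" "vr s < vl s"
      using that by (auto simp: t_def D_eq)
    have "vl s \<le> p t" "p t \<le> vr r" using vl(2) vr(2) * by auto
    with * show ?thesis by simp
  qed
  have "inj_on vr D"
    by (rule linorder_inj_onI') (metis decr less_irrefl)
  moreover have "vr ` D \<subseteq> p ` {0<..}" using vr(1) by (auto simp: D_eq)
  ultimately show "finite D" "card D \<le> card (p ` {0<..})"
    using fin by (auto intro: inj_on_finite card_inj_on_le)
  show "\<exists>a b. b < a \<and> (f \<longlongrightarrow> a) (at_left R) \<and> (f \<longlongrightarrow> b) (at_right R)" if "R \<in> D"
    using that lim_left lim_right by (intro exI[of _ "R * vl R"] exI[of _ "R * vr R"]) (auto simp: D_eq)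
  show "\<forall>\<^sub>F r in nhds R. p r = p R" if "0 < R" "isCont f R"
  proof -
    have "R \<notin> D" using that by (simp add: D_def)
    then have "vl R = vr R" using sandwich[OF that(1)] that(1) by (auto simp: D_eq)
    then show ?thesis by (rule const[OF that(1)])
  qed
qed

text \<open>At continuity points of \<open>f\<close> the factor \<open>p\<close> is locally
  constant, hence continuous on \<open>I\<close>; a continuous function with finite range on a
  connected set is constant.\<close>

lemma sawtooth_linear_piece:
  fixes p f :: "real \<Rightarrow> real"
  assumes anti: "antimono_on {0<..} p" and fin: "finite (p ` {0<..})"
    and f: "\<And>R. 0 < R \<Longrightarrow> f R = R * p R"
    and I: "is_interval I" "I \<subseteq> {R. 0 < R \<and> isCont f R}"
  shows "\<exists>v\<in>p ` {0<..}. \<forall>R\<in>I. f R = R * v"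
proof (cases "I = {}")
  case True
  then show ?thesis by (auto intro!: bexI[of _ 1])
next
  case False
  have "continuous_on I p"
    unfolding continuous_on_def
  proof
    fix R assume "R \<in> I"
    then have "0 < R" "isCont f R" using I by auto
    then have "\<forall>\<^sub>F r in nhds R. p r = p R" using sawtooth(4)[OF anti fin] f by blast
    then have "\<forall>\<^sub>F r in at R within I. p R = p r"
      by (auto simp: eventually_at_filter elim: eventually_mono)
    then show "(p \<longlongrightarrow> p R) (at R within I)"
      by (rule Lim_transform_eventually[OF tendsto_const])
  qed
  moreover have "finite (p ` I)" by (rule finite_subset[OF _ fin]) (use I in auto)
  moreover have "connected I" using I by (simp add: is_interval_connected_1)
  ultimately have "p constant_on I" by (rule continuous_finite_range_constant[rotated])
  then obtain v where "\<And>R. R \<in> I \<Longrightarrow> p R = v" by (auto simp: constant_on_def)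
  with False I f show ?thesis by (intro bexI[of _ v]) force+
qed

section \<open>Projections onto the active columns\<close>

text \<open>The orthogonal projection onto the span of the columns indexed by \<open>J\<close>;
  \<open>grad_formula\<close> is minus the projection onto its orthogonal complement.\<close>

definition proj :: "real^'k^'k \<Rightarrow> 'k set \<Rightarrow> real^'k^'k" where
  "proj A J = cols A J ** gram_inv A J ** transpose (cols A J)"

lemma grad_formula_proj: "grad_formula A J = proj A J - mat 1"
  by (simp add: grad_formula_def proj_def)

lemma cols_mult_diag_ind:
  assumes "I \<subseteq> J"
  shows "cols A J ** diag_ind I = cols A I"
  unfolding vec_eq_iff
proof (intro allI)
  fix i j
  have "(cols A J ** diag_ind I) $ i $ j
      = (\<Sum>k\<in>UNIV. if k = j then if j \<in> I then A $ i $ j else 0 else 0)"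
    unfolding matrix_matrix_mult_def cols_def diag_ind_def vec_lambda_beta
    by (intro sum.cong refl) (use assms in auto)
  then show "(cols A J ** diag_ind I) $ i $ j = cols A I $ i $ j"
    by (simp add: cols_def)
qed

lemma transpose_diag_ind: "transpose (diag_ind J) = diag_ind J"
  by (auto simp: diag_ind_def vec_eq_iff transpose_def)

text \<open>The normal equations: what the projection removes is orthogonal to every column in
  \<open>J\<close>.\<close>

lemma transpose_cols_proj:
  assumes "invertible A"
  shows "transpose (cols A J) ** proj A J = transpose (cols A J)"
proof -
  have "transpose (cols A J) ** proj A J
      = (transpose (cols A J) ** cols A J) ** gram_inv A J ** transpose (cols A J)"
    by (simp add: proj_def matrix_mul_assoc)
  also have "\<dots> = transpose (cols A J ** diag_ind J)"
    by (simp only: gram_inv_right[OF assms] matrix_transpose_mul transpose_diag_ind)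
  finally show ?thesis by (simp add: cols_mult_diag_ind)
qed

text \<open>Multiplying the normal equations from the left shows that the transpose of the
  projection equals the transpose times the projection, and that product is symmetric.\<close>

lemma transpose_proj:
  assumes "invertible A"
  shows "transpose (proj A J) = proj A J"
proof -
  have "transpose (proj A J) = cols A J ** transpose (gram_inv A J) ** transpose (cols A J)"
    by (simp add: proj_def matrix_transpose_mul matrix_mul_assoc)
  then have *: "transpose (proj A J) ** proj A J = transpose (proj A J)"
    by (metis transpose_cols_proj[OF assms] matrix_mul_assoc)
  then have "transpose (transpose (proj A J) ** proj A J) = proj A J"
    by simp
  with * show ?thesis by (metis matrix_transpose_mul transpose_transpose)
qed

lemma proj_mult_cols:
  assumes A: "invertible A" and "I \<subseteq> J"
  shows "proj A J ** cols A I = cols A I"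
proof -
  have "proj A J ** cols A J = transpose (transpose (cols A J) ** proj A J)"
    by (simp add: matrix_transpose_mul transpose_proj[OF A])
  then have "proj A J ** cols A J = cols A J"
    by (simp add: transpose_cols_proj[OF A])
  then show ?thesis
    by (metis cols_mult_diag_ind[OF assms(2)] matrix_mul_assoc)
qed

lemma proj_mult_proj:
  assumes A: "invertible A" and "I \<subseteq> J"
  shows "proj A J ** proj A I = proj A I" "proj A I ** proj A J = proj A I"
proof -
  show *: "proj A J ** proj A I = proj A I"
    using proj_mult_cols[OF assms] by (simp add: proj_def[of A I] matrix_mul_assoc)
  have "transpose (proj A J ** proj A I) = proj A I ** proj A J"
    by (simp add: matrix_transpose_mul transpose_proj[OF A])
  then show "proj A I ** proj A J = proj A I"
    by (simp add: * transpose_proj[OF A])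
qed

text \<open>By cyclicity the trace equals that of \<open>transpose Q ** S ** Q\<close>, a sum of
  values of the quadratic form of \<open>S\<close> at the columns of \<open>Q\<close>.\<close>

lemma trace_symmetric_idempotent_nonneg:
  assumes Q: "transpose Q = Q" "Q ** Q = Q" and S: "pos_def S"
  shows "0 \<le> trace (Q ** S)"
proof -
  have "trace (Q ** S) = trace (Q ** (Q ** S))" by (simp add: matrix_mul_assoc Q)
  also have "\<dots> = trace ((Q ** S) ** Q)" by (rule trace_mul_sym)
  also have "\<dots> = trace (transpose Q ** (S ** Q))" by (simp add: matrix_mul_assoc Q)
  also have "\<dots> = (\<Sum>i\<in>UNIV. column i Q \<bullet> (S *v column i Q))"
    unfolding trace_def
    by (simp add: matrix_matrix_mult_def matrix_vector_mult_def transpose_def column_def inner_vec_def)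
  also have "\<dots> \<ge> 0"
    using S unfolding pos_def_def by (intro sum_nonneg) (metis inner_zero_left less_eq_real_def)
  finally show ?thesis .
qed

text \<open>For nested index sets the difference of the two projections is again an orthogonal
  projection. This is where positive definiteness of \<open>S\<close> enters.\<close>

lemma trace_grad_formula_mono:
  assumes A: "invertible A" and S: "pos_def S" and IJ: "I \<subseteq> J"
  shows "trace (grad_formula A I ** S) \<le> trace (grad_formula A J ** S)"
proof -
  define Q where "Q = proj A J - proj A I"
  have "transpose Q = Q"
    using transpose_proj[OF A] by (simp add: Q_def transpose_def vec_eq_iff)
  moreover have "Q ** Q = Q"
    using proj_mult_proj[OF A IJ] proj_mult_proj(1)[OF A order_refl]
    by (simp add: Q_def matrix_eq matrix_vector_mul_assoc[symmetric] matrix_vector_mult_diff_rdistrib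
        matrix_vector_mult_diff_distrib)
  ultimately have "0 \<le> trace (Q ** S)"
    by (rule trace_symmetric_idempotent_nonneg[OF _ _ S])
  also have "trace (Q ** S) = trace (grad_formula A J ** S) - trace (grad_formula A I ** S)"
    by (simp add: Q_def grad_formula_proj trace_def matrix_matrix_mult_def left_diff_distrib
        sum_subtractf)
  finally show ?thesis by simp
qed

section \<open>Closed form of the shrinkage for a given sign vector\<close>

lemma transpose_cols_mult_vec:
  "(transpose (cols A J) *v u) $ j = (if j \<in> J then column j A \<bullet> u else 0)"
  by (simp add: matrix_vector_mult_def transpose_def cols_def column_def inner_vec_def del: transpose_matrix_vector)

lemma grad_formula_mult_cols:
  assumes "invertible A"
  shows "grad_formula A J *v (cols A J *v x) = 0"
proof -
  have "proj A J *v (cols A J *v x) = cols A J *v x"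
    by (simp add: matrix_vector_mul_assoc proj_mult_cols[OF assms])
  then show ?thesis
    by (simp add: grad_formula_proj matrix_vector_mult_diff_rdistrib)
qed

lemma grad_formula_orthogonal:
  assumes "invertible A"
  shows "(grad_formula A J *v x) \<bullet> (cols A J *v y) = 0"
proof -
  have "transpose (grad_formula A J) = grad_formula A J"
    using transpose_proj[OF assms] by (simp add: grad_formula_proj transpose_def vec_eq_iff mat_def)
  then have "(grad_formula A J *v x) \<bullet> (cols A J *v y) = x \<bullet> (grad_formula A J *v (cols A J *v y))"
    by (metis dot_lmul_matrix transpose_matrix_vector)
  then show ?thesis by (simp add: grad_formula_mult_cols[OF assms])
qed

text \<open>The vector on the left lies in the span of the active columns and has inner product
  \<open>e $ j\<close> with column \<open>j\<close> for active \<open>j\<close>. It is the direction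
  in which \<open>gfun\<close> moves with \<open>lam\<close>, up to sign, so its squared length is
  the coefficient of \<open>lam\<^sup>2\<close> in the loss.\<close>

lemma gram_form:
  assumes A: "invertible A"
  shows "(norm (cols A (active e) *v (gram_inv A (active e) *v e)))\<^sup>2 = e \<bullet> (gram_inv A (active e) *v e)"
proof -
  define C M where "C = cols A (active e)" and "M = gram_inv A (active e)"
  have "transpose C *v (C *v (M *v e)) = diag_ind (active e) *v e"
    using gram_inv_right[OF A, of "active e"]
    by (simp add: C_def M_def matrix_vector_mul_assoc matrix_mul_assoc del: transpose_matrix_vector)
  also have "\<dots> = e"
    by (simp add: vec_eq_iff diag_ind_mult_vec active_def)
  finally have *: "transpose C *v (C *v (M *v e)) = e" .
  have "(norm (C *v (M *v e)))\<^sup>2 = (transpose C *v (C *v (M *v e))) \<bullet> (M *v e)"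
    by (simp add: power2_norm_eq_inner dot_lmul_matrix)
  then show ?thesis unfolding * by (simp add: C_def M_def)
qed

lemma gram_form_nonneg:
  assumes "invertible A"
  shows "0 \<le> e \<bullet> (gram_inv A (active e) *v e)"
  by (metis gram_form[OF assms] zero_le_power2)

lemma gram_form_pos:
  assumes A: "invertible A" and "e \<noteq> 0"
  shows "0 < e \<bullet> (gram_inv A (active e) *v e)"
proof -
  have "transpose (cols A (active e)) *v (cols A (active e) *v (gram_inv A (active e) *v e))
      = diag_ind (active e) *v e"
    using gram_inv_right[OF A, of "active e"]
    by (simp add: matrix_vector_mul_assoc matrix_mul_assoc del: transpose_matrix_vector)
  also have "\<dots> = e"
    by (simp add: vec_eq_iff diag_ind_mult_vec active_def)
  finally have "cols A (active e) *v (gram_inv A (active e) *v e) \<noteq> 0"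
    using \<open>e \<noteq> 0\<close> by (metis matrix_vector_mult_0_right)
  then show ?thesis using gram_form[OF A, of e] by (metis zero_less_norm_iff zero_less_power)
qed

lemma active_eta: "active (eta A lam \<theta>) = {j. hfun A lam \<theta> $ j \<noteq> 0}"
  by (simp add: active_def eta_def sgn_eq_0_iff)

text \<open>The residual splits along the span of the active columns. Within the span its inner
  products with the columns are prescribed by \<open>kkt\<close>, which makes that part linear in
  \<open>lam\<close>; the orthogonal part sees only \<open>\<theta>\<close>, because the fit
  \<open>A *v h\<close> lies in the span.\<close>

lemma gfun_formula:
  assumes A: "invertible A" and lam: "0 \<le> lam" and e: "eta A lam \<theta> = e"
  defines "J \<equiv> active e"
  shows "gfun A lam \<theta> = grad_formula A J *v \<theta> - lam *\<^sub>R (cols A J *v (gram_inv A J *v e))"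
proof -
  define h u where "h = hfun A lam \<theta>" and "u = \<theta> - A *v h"
  have k: "kkt A lam \<theta> h" unfolding h_def by (rule kkt_hfun[OF A lam])
  have J: "J = {j. h $ j \<noteq> 0}" using active_eta[of A lam \<theta>] by (simp add: J_def e h_def)
  then have Ch: "cols A J *v h = A *v h" by (intro cols_mult_vec) simp
  have "transpose (cols A J) *v u = lam *\<^sub>R e"
    using k by (auto simp: vec_eq_iff transpose_cols_mult_vec u_def kkt_def J e[symmetric] eta_def
        h_def[symmetric] sgn_eq_0_iff simp del: transpose_matrix_vector)
  then have "proj A J *v u = lam *\<^sub>R (cols A J *v (gram_inv A J *v e))"
    by (simp add: proj_def matrix_vector_mul_assoc[symmetric] matrix_vector_mult_scaleR
        del: transpose_matrix_vector)
  moreover have "grad_formula A J *v u = grad_formula A J *v \<theta>"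
    using grad_formula_mult_cols[OF A, of J h]
    by (simp add: u_def Ch matrix_vector_mult_diff_distrib)
  moreover have "grad_formula A J *v u = proj A J *v u - u"
    by (simp add: grad_formula_proj matrix_vector_mult_diff_rdistrib)
  moreover have "gfun A lam \<theta> = (proj A J *v u - u) - proj A J *v u"
    by (simp add: gfun_eq[OF A] u_def h_def)
  ultimately show ?thesis by simp
qed

lemma norm_gfun_formula:
  assumes A: "invertible A" and lam: "0 \<le> lam" and e: "eta A lam \<theta> = e"
  defines "J \<equiv> active e"
  shows "(norm (gfun A lam \<theta>))\<^sup>2 = (norm (grad_formula A J *v \<theta>))\<^sup>2 + lam\<^sup>2 * (e \<bullet> (gram_inv A J *v e))"
proof -
  define x w where "x = grad_formula A J *v \<theta>" and "w = cols A J *v (gram_inv A J *v e)"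
  have "x \<bullet> w = 0"
    unfolding x_def w_def by (rule grad_formula_orthogonal[OF A])
  moreover have "(norm w)\<^sup>2 = e \<bullet> (gram_inv A J *v e)"
    unfolding w_def J_def by (rule gram_form[OF A])
  moreover have "gfun A lam \<theta> = x - lam *\<^sub>R w"
    using gfun_formula[OF A lam e] by (simp add: x_def w_def J_def)
  ultimately show ?thesis
    unfolding x_def[symmetric] power2_norm_eq_inner
    by (simp add: inner_diff_left inner_diff_right inner_commute power2_eq_square)
qed

section \<open>Derivative and segments of constant sign\<close>

lemma isCont_hfun:
  assumes A: "invertible A" and lam: "0 \<le> lam"
  shows "isCont (hfun A lam) \<theta>"
proof -
  have "1-lipschitz_on UNIV (gfun A lam)"
    by (rule lipschitz_onI) (use gfun_dist_le[OF A lam] in auto)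
  then have "continuous_on UNIV (gfun A lam)"
    by (rule lipschitz_on_continuous_on)
  then have "isCont (gfun A lam) \<theta>"
    by (simp add: continuous_on_eq_continuous_at)
  then have "isCont (\<lambda>\<theta>. matrix_inv A *v (\<theta> + gfun A lam \<theta>)) \<theta>"
    by (intro bounded_linear.isCont[OF matrix_vector_mul_bounded_linear] continuous_add continuous_ident)
  then show ?thesis by (simp add: hfun_def[abs_def])
qed

lemma tendsto_hfun_param:
  assumes A: "invertible A" and x: "0 \<le> x"
  shows "((\<lambda>lam. hfun A lam \<theta>) \<longlongrightarrow> hfun A x \<theta>) (at x within {0..})"
proof -
  have "((\<lambda>lam. gfun A lam \<theta>) \<longlongrightarrow> gfun A x \<theta>) (at x within {0..})"
    using continuous_on_gfun_param[OF A, of \<theta>] x by (simp add: continuous_on_def)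
  then show ?thesis
    unfolding hfun_def
    by (intro bounded_linear.tendsto[OF matrix_vector_mul_bounded_linear] tendsto_intros)
qed

text \<open>By continuity in \<open>lam\<close> a nonzero coordinate of \<open>hfun\<close> remains
  nonzero nearby, whereas a zero one may become active.\<close>

lemma active_eta_lsc:
  assumes A: "invertible A" and x: "0 \<le> x"
  shows "\<exists>d>0. \<forall>y\<ge>0. \<bar>y - x\<bar> < d \<longrightarrow> active (eta A x \<theta>) \<subseteq> active (eta A y \<theta>)"
proof -
  have "\<forall>\<^sub>F y in at x within {0..}. hfun A x \<theta> $ j \<noteq> 0 \<longrightarrow> hfun A y \<theta> $ j \<noteq> 0" for j
  proof (cases "hfun A x \<theta> $ j = 0")
    case False
    have "((\<lambda>y. hfun A y \<theta> $ j) \<longlongrightarrow> hfun A x \<theta> $ j) (at x within {0..})"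
      by (intro tendsto_vec_nth tendsto_hfun_param A x)
    from tendsto_imp_eventually_ne[OF this False] show ?thesis
      by (rule eventually_mono) simp
  qed simp
  then have "\<forall>\<^sub>F y in at x within {0..}. \<forall>j. hfun A x \<theta> $ j \<noteq> 0 \<longrightarrow> hfun A y \<theta> $ j \<noteq> 0"
    by (rule eventually_all_finite)
  then obtain d where d: "d > 0"
    "\<And>y. 0 \<le> y \<Longrightarrow> y \<noteq> x \<Longrightarrow> dist y x < d \<Longrightarrow> \<forall>j. hfun A x \<theta> $ j \<noteq> 0 \<longrightarrow> hfun A y \<theta> $ j \<noteq> 0"
    unfolding eventually_at by (metis atLeast_iff)
  have "active (eta A x \<theta>) \<subseteq> active (eta A y \<theta>)" if "0 \<le> y" "\<bar>y - x\<bar> < d" for y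
    using d(2)[of y] that by (cases "y = x") (auto simp: active_eta dist_real_def)
  with d(1) show ?thesis by blast
qed

text \<open>A one-sided segment suffices: \<open>f' v\<close> and \<open>w\<close> are both vector
  derivatives at the endpoint of a nondegenerate closed interval, and these are unique.\<close>

lemma differentiable_directional_unique:
  fixes f :: "'a::real_normed_vector \<Rightarrow> 'b::real_normed_vector"
  assumes f: "(f has_derivative f') (at x)" and d: "0 < d"
    and affine: "\<And>t. 0 \<le> t \<Longrightarrow> t \<le> d \<Longrightarrow> f (x + t *\<^sub>R v) = f x + t *\<^sub>R w"
  shows "f' v = w"
proof -
  have "((\<lambda>t. x + t *\<^sub>R v) has_vector_derivative v) (at 0 within {0..d})"
    by (auto intro!: derivative_eq_intros)
  moreover have "(f has_derivative f') (at (x + 0 *\<^sub>R v) within (\<lambda>t. x + t *\<^sub>R v) ` {0..d})"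
    using f by (simp add: has_derivative_at_withinI)
  ultimately have "(f \<circ> (\<lambda>t. x + t *\<^sub>R v) has_vector_derivative f' v) (at 0 within {0..d})"
    by (rule vector_derivative_diff_chain_within)
  moreover have "((\<lambda>t. f x + t *\<^sub>R w) has_vector_derivative w) (at 0 within {0..d})"
    by (auto intro!: derivative_eq_intros)
  then have "(f \<circ> (\<lambda>t. x + t *\<^sub>R v) has_vector_derivative w) (at 0 within {0..d})"
    by (rule has_vector_derivative_transform[rotated 2]) (use d affine in auto)
  ultimately show ?thesis
    using d by (auto intro: vector_derivative_unique_within_closed_interval[of 0 d 0])
qed

lemma column_inner_eqI:
  fixes A :: "real^'n^'n"
  assumes A: "invertible A" and eq: "\<And>j. column j A \<bullet> x = column j A \<bullet> y"
  shows "x = y"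
proof -
  have "(A *v z) \<bullet> (x - y) = 0" for z
    by (simp add: mult_vec_inner inner_diff_right eq)
  from this[of "matrix_inv A *v (x - y)"] show ?thesis
    by (simp add: invertible_mult_inv[OF A])
qed

text \<open>The set of \<open>\<theta>\<close> with a given sign vector is convex and full-dimensional: from every one of its
  points one can move a little along each column of \<open>A\<^sub>J\<close> and, in one direction at least, along each
  dual vector \<open>row j (matrix_inv A)\<close> with \<open>j \<notin> J\<close>. On it \<open>g\<close> is affine, which determines the
  derivative even at boundary points, should it exist there.\<close>

lemma jacobian_gfun:
  fixes A :: "real^'k^'k"
  assumes A: "invertible A" and lam: "0 < lam" and diff: "gfun A lam differentiable (at \<theta>)"
  shows "jacobian (gfun A lam) (at \<theta>) = grad_formula A (active (eta A lam \<theta>))"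
proof -
  define h u J where "h = hfun A lam \<theta>" and "u = \<theta> - A *v h" and "J = active (eta A lam \<theta>)"
  define L where "L = jacobian (gfun A lam) (at \<theta>)"
  define G where "G = grad_formula A J"
  define b where "b j = row j (matrix_inv A)" for j
  have L: "(gfun A lam has_derivative ((*v) L)) (at \<theta>)"
    using diff unfolding jacobian_works L_def .
  have k: "kkt A lam \<theta> h" unfolding h_def using kkt_hfun[OF A] lam by simp
  then have k1: "\<bar>column j A \<bullet> u\<bar> \<le> lam" "h $ j \<noteq> 0 \<Longrightarrow> column j A \<bullet> u = lam * sgn (h $ j)" for j
    by (auto simp: kkt_def u_def)
  have J: "J = {j. h $ j \<noteq> 0}" by (simp add: J_def active_eta h_def)
  have g: "gfun A lam \<theta> = - u" by (simp add: u_def h_def gfun_eq[OF A])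
  \<comment> \<open>A step along an active column is absorbed by \<open>h\<close> alone and leaves
    the residual fixed. Half of \<open>\<bar>h $ j\<bar>\<close> is short enough to preserve the
    sign of \<open>h $ j\<close>.\<close>
  have La: "L *v column j A = 0" if j: "j \<in> J" for j
  proof (rule differentiable_directional_unique[OF L])
    show "0 < \<bar>h $ j\<bar> / 2" using j by (simp add: J)
    fix t assume t: "0 \<le> t" "t \<le> \<bar>h $ j\<bar> / 2"
    define h' where "h' = h + t *\<^sub>R axis j 1"
    have res: "\<theta> + t *\<^sub>R column j A - A *v h' = u"
      by (simp add: h'_def u_def matrix_vector_right_distrib matrix_vector_mult_scaleR matrix_vector_mult_basis)
    have sgn: "sgn (h' $ i) = sgn (h $ i)" for i
      using t j by (auto simp: h'_def axis_def J sgn_if split: if_splits)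
    then have "h' $ i \<noteq> 0 \<longleftrightarrow> h $ i \<noteq> 0" for i by (metis sgn_eq_0_iff)
    with k1 sgn have "kkt A lam (\<theta> + t *\<^sub>R column j A) h'"
      by (simp add: kkt_def res)
    from kkt_gfun[OF A this] res have "gfun A lam (\<theta> + t *\<^sub>R column j A) = - u"
      by (metis minus_diff_eq)
    then show "gfun A lam (\<theta> + t *\<^sub>R column j A) = gfun A lam \<theta> + t *\<^sub>R 0"
      by (simp add: g)
  qed
  have Lb: "L *v b j = - b j" if j: "j \<notin> J" for j
  proof -
    \<comment> \<open>The direction points into \<open>[-lam, lam]\<close> as seen from
      \<open>column j A \<bullet> u\<close>. Even from an endpoint there is room for a step of
      length \<open>lam\<close>, and \<open>h\<close> need not change.\<close>
    define s :: real where "s = (if column j A \<bullet> u > 0 then - 1 else 1)"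
    have "L *v (s *\<^sub>R b j) = - s *\<^sub>R b j"
    proof (rule differentiable_directional_unique[OF L lam])
      fix t assume t: "0 \<le> t" "t \<le> lam"
      have res: "\<theta> + t *\<^sub>R s *\<^sub>R b j - A *v h = u + (t * s) *\<^sub>R b j"
        by (simp add: u_def)
      have col: "column i A \<bullet> (u + (t * s) *\<^sub>R b j) = column i A \<bullet> u + (if i = j then t * s else 0)" for i
        by (simp add: inner_add_right b_def column_inner_row_inv[OF A])
      have "kkt A lam (\<theta> + t *\<^sub>R s *\<^sub>R b j) h"
        unfolding kkt_def res col
      proof (intro allI conjI impI)
        fix i
        show "\<bar>column i A \<bullet> u + (if i = j then t * s else 0)\<bar> \<le> lam"
          using k1(1)[of i] t by (auto simp: s_def)
        show "column i A \<bullet> u + (if i = j then t * s else 0) = lam * sgn (h $ i)" if "h $ i \<noteq> 0"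
          using k1(2)[OF that] that j by (auto simp: J)
      qed
      from kkt_gfun[OF A this] res
      show "gfun A lam (\<theta> + t *\<^sub>R s *\<^sub>R b j) = gfun A lam \<theta> + t *\<^sub>R - s *\<^sub>R b j"
        by (simp add: g u_def)
    qed
    then have "s *\<^sub>R (L *v b j) = s *\<^sub>R - b j"
      by (simp add: matrix_vector_mult_scaleR)
    moreover have "s \<noteq> 0" by (simp add: s_def)
    ultimately show ?thesis by (metis scaleR_cancel_left)
  qed
  have L_sum: "L *v (\<Sum>j\<in>UNIV. f j) = (\<Sum>j\<in>UNIV. L *v f j)" for f :: "'k \<Rightarrow> real^'k"
    by (rule linear_sum[OF matrix_vector_mul_linear])
  have "L *v x = G *v x" for x
  proof -
    \<comment> \<open>The part of \<open>x\<close> in the span of the active columns is killed by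
      \<open>L\<close>. The rest \<open>y\<close> is orthogonal to them, so its expansion in the
      dual basis uses only \<open>b j\<close> with \<open>j \<notin> J\<close>, which
      \<open>L\<close> negates.\<close>
    define z y where "z = gram_inv A J *v (transpose (cols A J) *v x)" and "y = x - proj A J *v x"
    have Cz: "proj A J *v x = cols A J *v z"
      by (simp add: proj_def z_def matrix_vector_mul_assoc[symmetric] del: transpose_matrix_vector)
    have "transpose (cols A J) *v y = 0"
      by (simp add: y_def matrix_vector_mult_diff_distrib matrix_vector_mul_assoc
          transpose_cols_proj[OF A] del: transpose_matrix_vector)
    then have y0: "column j A \<bullet> y = 0" if "j \<in> J" for j
      using that by (metis transpose_cols_mult_vec zero_index)
    have y: "y = (\<Sum>j\<in>UNIV. (column j A \<bullet> y) *\<^sub>R b j)"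
      by (rule column_inner_eqI[OF A]) (simp add: inner_sum_right b_def column_inner_row_inv[OF A]
          if_distrib[of "\<lambda>c. _ * c"] cong: if_cong)
    have "L *v y = (\<Sum>j\<in>UNIV. (column j A \<bullet> y) *\<^sub>R (L *v b j))"
      by (subst y) (simp add: L_sum matrix_vector_mult_scaleR)
    also have "\<dots> = (\<Sum>j\<in>UNIV. (column j A \<bullet> y) *\<^sub>R - b j)"
    proof (intro sum.cong refl)
      fix j
      show "(column j A \<bullet> y) *\<^sub>R (L *v b j) = (column j A \<bullet> y) *\<^sub>R - b j"
        by (cases "j \<in> J") (simp_all add: y0 Lb)
    qed
    also have "\<dots> = - y"
      by (subst (2) y) (simp add: sum_negf)
    finally have Ly: "L *v y = - y" .
    have "column j (cols A J) = (if j \<in> J then column j A else 0)" for j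
      by (auto simp: column_def cols_def vec_eq_iff)
    then have "L *v (cols A J *v z) = 0"
      by (auto simp: matrix_mult_sum[of "cols A J"] scalar_mult_eq_scaleR L_sum
          matrix_vector_mult_scaleR La intro!: sum.neutral)
    then have "L *v x = - y"
      using Ly by (simp add: y_def Cz matrix_vector_mult_diff_distrib)
    also have "\<dots> = G *v x"
      by (simp add: G_def grad_formula_proj y_def matrix_vector_mult_diff_rdistrib)
    finally show ?thesis .
  qed
  then show ?thesis unfolding L_def[symmetric] G_def J_def by (simp add: matrix_eq)
qed

text \<open>The case distinction in the definition disappears, so the gradient depends on the active
  set alone, also at kinks and at \<open>lam = 0\<close>.\<close>

lemma grad_g_eq:
  assumes "invertible A"
  shows "grad_g A lam \<theta> = grad_formula A (active (eta A lam \<theta>))"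
  by (simp add: grad_g_def jacobian_gfun[OF assms])

text \<open>The sign vector is constant near \<open>\<theta>\<close>: nonzero coordinates keep their
  sign by continuity, and an inactive one stays zero because activity would force its dual
  coordinate to have modulus \<open>lam\<close>. Nearby, \<open>gfun\<close> is therefore the affine
  map \<open>F\<close>.\<close>

lemma has_derivative_gfun:
  assumes A: "invertible A" and lam: "0 < lam"
    and strict: "\<And>j. j \<notin> active (eta A lam \<theta>) \<Longrightarrow> \<bar>column j A \<bullet> (\<theta> - A *v hfun A lam \<theta>)\<bar> < lam"
  shows "(gfun A lam has_derivative (*v) (grad_g A lam \<theta>)) (at \<theta>)"
proof -
  define e where "e = eta A lam \<theta>"
  define F where "F \<tau> = grad_formula A (active e) *v \<tau> - lam *\<^sub>R (cols A (active e) *v (gram_inv A (active e) *v e))" for \<tau>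
  have h: "(hfun A lam \<longlongrightarrow> hfun A lam \<theta>) (nhds \<theta>)"
    using isCont_hfun[OF A, of lam \<theta>] lam by (simp add: continuous_at tendsto_nhds_iff)
  have "\<forall>\<^sub>F \<tau> in nhds \<theta>. eta A lam \<tau> $ j = e $ j" for j
  proof (cases "hfun A lam \<theta> $ j = 0")
    case False
    have hj: "((\<lambda>\<tau>. hfun A lam \<tau> $ j) \<longlongrightarrow> hfun A lam \<theta> $ j) (nhds \<theta>)"
      by (intro tendsto_vec_nth h)
    show ?thesis
    proof (cases "hfun A lam \<theta> $ j > 0")
      case True
      from order_tendstoD(1)[OF hj True] show ?thesis
        by (rule eventually_mono) (use True in \<open>simp add: e_def eta_def\<close>)
    next
      case False
      with \<open>hfun A lam \<theta> $ j \<noteq> 0\<close> have neg: "hfun A lam \<theta> $ j < 0" by simp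
      from order_tendstoD(2)[OF hj neg] show ?thesis
        by (rule eventually_mono) (use neg in \<open>simp add: e_def eta_def\<close>)
    qed
  next
    case True
    have "((\<lambda>\<tau>. A *v hfun A lam \<tau>) \<longlongrightarrow> A *v hfun A lam \<theta>) (nhds \<theta>)"
      by (rule bounded_linear.tendsto[OF matrix_vector_mul_bounded_linear h])
    moreover have "((\<lambda>\<tau>. \<tau>) \<longlongrightarrow> \<theta>) (nhds \<theta>)" by (rule filterlim_ident)
    ultimately have "((\<lambda>\<tau>. \<bar>column j A \<bullet> (\<tau> - A *v hfun A lam \<tau>)\<bar>)
        \<longlongrightarrow> \<bar>column j A \<bullet> (\<theta> - A *v hfun A lam \<theta>)\<bar>) (nhds \<theta>)"
      by (intro tendsto_intros)
    moreover have "\<bar>column j A \<bullet> (\<theta> - A *v hfun A lam \<theta>)\<bar> < lam"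
      by (rule strict) (simp add: active_eta True)
    ultimately have "\<forall>\<^sub>F \<tau> in nhds \<theta>. \<bar>column j A \<bullet> (\<tau> - A *v hfun A lam \<tau>)\<bar> < lam"
      by (rule order_tendstoD(2))
    then show ?thesis
    proof (rule eventually_mono)
      fix \<tau> assume less: "\<bar>column j A \<bullet> (\<tau> - A *v hfun A lam \<tau>)\<bar> < lam"
      have "kkt A lam \<tau> (hfun A lam \<tau>)" using kkt_hfun[OF A] lam by simp
      with less lam have "hfun A lam \<tau> $ j = 0"
        by (force simp: kkt_def abs_mult abs_sgn_eq)
      with True show "eta A lam \<tau> $ j = e $ j" by (simp add: e_def eta_def)
    qed
  qed
  then have "\<forall>\<^sub>F \<tau> in nhds \<theta>. \<forall>j. eta A lam \<tau> $ j = e $ j"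
    by (rule eventually_all_finite)
  then have "\<forall>\<^sub>F \<tau> in nhds \<theta>. F \<tau> = gfun A lam \<tau>"
    by (rule eventually_mono) (use lam in \<open>auto simp: F_def vec_eq_iff[symmetric] intro!: gfun_formula[OF A, symmetric]\<close>)
  then have "\<forall>\<^sub>F \<tau> in at \<theta>. F \<tau> = gfun A lam \<tau>" "F \<theta> = gfun A lam \<theta>"
    by (auto simp: eventually_at_filter elim: eventually_mono dest: eventually_nhds_x_imp_x)
  moreover have "(F has_derivative (*v) (grad_formula A (active e))) (at \<theta>)"
    unfolding F_def
    by (auto intro!: derivative_eq_intros linear_imp_has_derivative[OF matrix_vector_mul_linear])
  ultimately have "(gfun A lam has_derivative (*v) (grad_formula A (active e))) (at \<theta>)"
    by (intro has_derivative_transform_eventually[of F _ \<theta> UNIV "gfun A lam"]) auto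
  then show ?thesis by (simp add: grad_g_eq[OF A] e_def)
qed

text \<open>For a fixed sign pattern the conditions in \<open>kkt\<close> are preserved by convex
  combinations of the pairs \<open>(lam, h)\<close>, and combining vectors of equal sign pattern
  keeps the pattern.\<close>

lemma convex_segment:
  assumes A: "invertible A"
  shows "convex (segment A \<theta> e)"
proof (rule convexI)
  fix x y a b :: real
  assume "x \<in> segment A \<theta> e" "y \<in> segment A \<theta> e" and ab: "0 \<le> a" "0 \<le> b" "a + b = 1"
  then have x: "0 \<le> x" "eta A x \<theta> = e" and y: "0 \<le> y" "eta A y \<theta> = e"
    by (auto simp: segment_def)
  define h k where "h = hfun A x \<theta>" and "k = hfun A y \<theta>"
  have "kkt A x \<theta> h" "kkt A y \<theta> k" using kkt_hfun[OF A] x y by (simp_all add: h_def k_def)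
  then have kk: "\<bar>column j A \<bullet> (\<theta> - A *v h)\<bar> \<le> x" "h $ j \<noteq> 0 \<Longrightarrow> column j A \<bullet> (\<theta> - A *v h) = x * sgn (h $ j)"
    "\<bar>column j A \<bullet> (\<theta> - A *v k)\<bar> \<le> y" "k $ j \<noteq> 0 \<Longrightarrow> column j A \<bullet> (\<theta> - A *v k) = y * sgn (k $ j)" for j
    by (auto simp: kkt_def)
  have sgn: "sgn (h $ j) = e $ j" "sgn (k $ j) = e $ j" for j
    using x(2)[symmetric] y(2) by (simp_all add: eta_def h_def k_def vec_eq_iff)
  define m where "m = a *\<^sub>R h + b *\<^sub>R k"
  have m: "sgn (m $ j) = e $ j" for j
  proof -
    have "sgn (a * h $ j + b * k $ j) = sgn (h $ j)" if "sgn (h $ j) = sgn (k $ j)"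
    proof -
      show ?thesis
      proof (cases "h $ j" "0::real" rule: linorder_cases)
        case less
        then have "k $ j < 0" using that by (metis sgn_less)
        with less have "a * h $ j + b * k $ j < 0"
          using ab by (cases "a = 0") (auto intro!: add_neg_nonpos simp: mult_pos_neg mult_nonneg_nonpos)
        with less show ?thesis by simp
      next
        case equal
        then have "k $ j = 0" using that by (metis sgn_eq_0_iff)
        with equal show ?thesis by simp
      next
        case greater
        then have "k $ j > 0" using that by (metis sgn_greater)
        with greater have "a * h $ j + b * k $ j > 0"
          using ab by (cases "a = 0") (auto intro: add_pos_nonneg)
        with greater show ?thesis by simp
      qed
    qed
    then show ?thesis by (simp add: m_def sgn)
  qed
  have "\<theta> = a *\<^sub>R \<theta> + b *\<^sub>R \<theta>" using ab by (simp flip: scaleR_left_distrib)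
  then have res: "\<theta> - A *v m = a *\<^sub>R (\<theta> - A *v h) + b *\<^sub>R (\<theta> - A *v k)"
    by (simp add: m_def matrix_vector_right_distrib matrix_vector_mult_scaleR scaleR_diff_right)
  have "kkt A (a * x + b * y) \<theta> m"
    unfolding kkt_def
  proof (intro allI conjI impI)
    fix j
    have col: "column j A \<bullet> (\<theta> - A *v m)
        = a * (column j A \<bullet> (\<theta> - A *v h)) + b * (column j A \<bullet> (\<theta> - A *v k))"
      by (simp add: res inner_add_right)
    have "\<bar>column j A \<bullet> (\<theta> - A *v m)\<bar>
        \<le> \<bar>a * (column j A \<bullet> (\<theta> - A *v h))\<bar> + \<bar>b * (column j A \<bullet> (\<theta> - A *v k))\<bar>"
      unfolding col by (rule abs_triangle_ineq)
    also have "\<dots> \<le> a * x + b * y"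
      unfolding abs_mult using ab kk by (intro add_mono mult_mono) auto
    finally show "\<bar>column j A \<bullet> (\<theta> - A *v m)\<bar> \<le> a * x + b * y" .
    assume "m $ j \<noteq> 0"
    then have nz: "h $ j \<noteq> 0" "k $ j \<noteq> 0" using m[of j] sgn[of j] by (auto simp: sgn_eq_0_iff)
    then show "column j A \<bullet> (\<theta> - A *v m) = (a * x + b * y) * sgn (m $ j)"
      unfolding col kk(2)[OF nz(1)] kk(4)[OF nz(2)] m sgn by (simp add: algebra_simps)
  qed
  then have "hfun A (a * x + b * y) \<theta> = m" by (rule kkt_hfun_unique[OF A])
  with m have "eta A (a * x + b * y) \<theta> = e" by (simp add: eta_def vec_eq_iff)
  with x y ab show "a *\<^sub>R x + b *\<^sub>R y \<in> segment A \<theta> e"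
    by (simp add: segment_def)
qed

lemma SURE_segment:
  assumes A: "invertible A" and "lam \<in> segment A \<theta> e"
  shows "SURE A S lam \<theta>
    = 1/2 * (trace S + (norm (grad_formula A (active e) *v \<theta>))\<^sup>2 + 2 * trace (grad_formula A (active e) ** S))
      + 1/2 * lam\<^sup>2 * (e \<bullet> (gram_inv A (active e) *v e))"
  using assms norm_gfun_formula[OF A, of lam \<theta> e]
  by (simp add: SURE_def segment_def grad_g_eq[OF A] algebra_simps)

lemma card_sign_vectors:
  "finite {e :: real^'k. \<forall>i. e $ i \<in> {-1, 0, 1}}" "card {e :: real^'k. \<forall>i. e $ i \<in> {-1, 0, 1}} \<le> 3 ^ CARD('k)"
proof -
  let ?E = "{e :: real^'k. \<forall>i. e $ i \<in> {-1, 0, 1}}"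
  let ?F = "UNIV \<rightarrow>\<^sub>E {-1, 0, 1 :: real} :: ('k \<Rightarrow> real) set"
  have inj: "inj_on vec_nth ?E" by (auto simp: inj_on_def vec_nth_inject)
  have sub: "vec_nth ` ?E \<subseteq> ?F" by (auto simp: PiE_UNIV_domain)
  have fin: "finite ?F" by (intro finite_PiE) auto
  have "card {-1, 0, 1 :: real} = 3" by simp
  then have "card ?F = 3 ^ CARD('k)" by (simp only: card_PiE[OF finite] prod_constant)
  with inj sub fin show "finite ?E" "card ?E \<le> 3 ^ CARD('k)"
    using card_inj_on_le[OF inj sub fin] by (auto intro: inj_on_finite)
qed

lemma eta_sign: "eta A lam \<theta> $ i \<in> {-1, 0, 1}"
  by (simp add: eta_def sgn_if)

section \<open>Rescaling and the shrinkage path\<close>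

lemma local_minimizers_rescale_mem:
  fixes f g :: "real \<Rightarrow> real"
  assumes R: "0 < R" and fg: "\<And>x. 0 \<le> x \<Longrightarrow> f x = g (x / R)" and x: "x \<in> local_minimizers g"
  shows "R * x \<in> local_minimizers f"
proof -
  obtain e where x0: "0 \<le> x" and e: "e > 0"
    "\<And>y. 0 \<le> y \<Longrightarrow> \<bar>y - x\<bar> < e \<Longrightarrow> g x \<le> g y \<and> (y < x \<longrightarrow> g x < g y)"
    using x by (auto simp: local_minimizers_def)
  have "f (R * x) \<le> f y \<and> (y < R * x \<longrightarrow> f (R * x) < f y)" if y: "0 \<le> y" "\<bar>y - R * x\<bar> < R * e" for y
  proof -
    have "y / R - x = (y - R * x) / R" using R by (simp add: field_simps)
    then have "\<bar>y / R - x\<bar> < e" using y R by (simp add: pos_divide_less_eq mult.commute)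
    moreover have "f (R * x) = g x" "f y = g (y / R)" "y < R * x \<longleftrightarrow> y / R < x"
      using fg[of "R * x"] fg[of y] y R x0 by (auto simp: pos_divide_less_eq mult.commute)
    ultimately show ?thesis using e(2)[of "y / R"] y R by simp
  qed
  moreover have "0 < R * e" "0 \<le> R * x" using R e x0 by simp_all
  ultimately show ?thesis
    unfolding local_minimizers_def by blast
qed

lemma local_minimizers_rescale:
  fixes f g :: "real \<Rightarrow> real"
  assumes R: "0 < R" and fg: "\<And>x. 0 \<le> x \<Longrightarrow> f x = g (x / R)"
  shows "local_minimizers f = (*) R ` local_minimizers g"
proof
  show "(*) R ` local_minimizers g \<subseteq> local_minimizers f"
    using local_minimizers_rescale_mem[where f = f and g = g, OF R fg] by blast
  show "local_minimizers f \<subseteq> (*) R ` local_minimizers g"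
  proof
    fix x assume "x \<in> local_minimizers f"
    then have "1 / R * x \<in> local_minimizers g"
      using R fg by (intro local_minimizers_rescale_mem[of "1 / R" g f]) auto
    then show "x \<in> (*) R ` local_minimizers g"
      using R by (intro image_eqI[of _ _ "1 / R * x"]) auto
  qed
qed

lemma global_minimizers_rescale:
  fixes f g :: "real \<Rightarrow> real"
  assumes R: "0 < R" and fg: "\<And>x. 0 \<le> x \<Longrightarrow> f x = g (x / R)"
  shows "x \<in> global_minimizers f \<longleftrightarrow> x / R \<in> global_minimizers g"
proof -
  have "(\<forall>y\<ge>0. f x \<le> f y) \<longleftrightarrow> (\<forall>y\<ge>0. g (x / R) \<le> g y)" if x: "0 \<le> x"
  proof (intro iffI allI impI)
    fix y :: real assume "\<forall>y\<ge>0. f x \<le> f y" "0 \<le> y"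
    then have "f x \<le> f (R * y)" using R by simp
    then show "g (x / R) \<le> g y" using fg[of x] fg[of "R * y"] x R \<open>0 \<le> y\<close> by simp
  next
    fix y :: real assume "\<forall>y\<ge>0. g (x / R) \<le> g y" "0 \<le> y"
    then show "f x \<le> f y" using fg[of x] fg[of y] x R by simp
  qed
  then show ?thesis using R by (auto simp: global_minimizers_def zero_le_divide_iff)
qed

lemma finite_real_set_enum:
  fixes X :: "real set"
  assumes "finite X"
  obtains l :: "nat \<Rightarrow> real" where "strict_mono_on {1..card X} l" "X = l ` {1..card X}"
proof
  define xs where "xs = sorted_list_of_set X"
  \<comment> \<open>The enumeration starts at 1, list positions at 0.\<close>
  define l where "l i = xs ! (i - 1)" for i
  have len: "length xs = card X" and set: "set xs = X" and srt: "sorted_wrt (<) xs"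
    using assms by (simp_all add: xs_def)
  show "strict_mono_on {1..card X} l"
    by (rule strict_mono_onI) (auto simp: l_def len intro!: sorted_wrt_nth_less[OF srt])
  have "set xs = (!) xs ` {..<length xs}"
    by (auto simp: set_conv_nth)
  then have "X = (!) xs ` {..<card X}"
    unfolding set len .
  also have "{..<card X} = (\<lambda>i. i - 1) ` {1..card X}"
    by (auto simp: image_iff intro!: bexI[of _ "Suc _"])
  finally show "X = l ` {1..card X}" by (simp add: image_image l_def)
qed

lemma segment_properties:
  fixes A :: "real^'k^'k"
  assumes A: "invertible A"
  shows "let seg = segment A \<theta> e; J = active e; q = e \<bullet> (gram_inv A J *v e) in
           is_interval seg \<and>
           continuous_on seg (\<lambda>lam. SURE A S lam \<theta>) \<and>
           (\<forall>lam\<in>seg.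
              grad_g A lam \<theta> = cols A J ** gram_inv A J ** transpose (cols A J) - mat 1 \<and>
              (0 < lam \<and> (\<forall>j. j \<notin> J \<longrightarrow> \<bar>column j A \<bullet> (\<theta> - A *v hfun A lam \<theta>)\<bar> < lam) \<longrightarrow>
                 (gfun A lam has_derivative (*v) (grad_g A lam \<theta>)) (at \<theta>)) \<and>
              (norm (gfun A lam \<theta>))\<^sup>2 = (norm (grad_g A lam \<theta> *v \<theta>))\<^sup>2 + lam\<^sup>2 * q) \<and>
           (\<exists>c. \<forall>lam\<in>seg. SURE A S lam \<theta> = c + 1/2 * lam\<^sup>2 * q) \<and>
           mono_on seg (\<lambda>lam. SURE A S lam \<theta>) \<and>
           (e \<noteq> 0 \<longrightarrow> strict_mono_on seg (\<lambda>lam. SURE A S lam \<theta>))"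
proof -
  define seg J q where "seg = segment A \<theta> e" and "J = active e" and "q = e \<bullet> (gram_inv A J *v e)"
  have seg: "0 \<le> lam" "eta A lam \<theta> = e" if "lam \<in> seg" for lam
    using that by (auto simp: seg_def segment_def)
  obtain c where c: "\<And>lam. lam \<in> seg \<Longrightarrow> SURE A S lam \<theta> = c + 1/2 * lam\<^sup>2 * q"
    using SURE_segment[OF A] unfolding seg_def q_def J_def by blast
  have q0: "0 \<le> q" unfolding q_def J_def by (rule gram_form_nonneg[OF A])
  have q1: "0 < q" if "e \<noteq> 0" unfolding q_def J_def by (rule gram_form_pos[OF A that])
  have "is_interval seg"
    unfolding seg_def is_interval_convex_1 by (rule convex_segment[OF A])
  moreover have "continuous_on seg (\<lambda>lam. SURE A S lam \<theta>)"
  proof (rule continuous_on_eq)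
    show "continuous_on seg (\<lambda>lam. c + 1/2 * lam\<^sup>2 * q)" by (intro continuous_intros)
  qed (simp add: c)
  moreover have "grad_g A lam \<theta> = cols A J ** gram_inv A J ** transpose (cols A J) - mat 1"
    if "lam \<in> seg" for lam
    using seg[OF that] by (simp add: grad_g_eq[OF A] grad_formula_def J_def)
  moreover have "(gfun A lam has_derivative (*v) (grad_g A lam \<theta>)) (at \<theta>)"
    if "lam \<in> seg" "0 < lam \<and> (\<forall>j. j \<notin> J \<longrightarrow> \<bar>column j A \<bullet> (\<theta> - A *v hfun A lam \<theta>)\<bar> < lam)" for lam
    using seg[OF that(1)] that(2) by (intro has_derivative_gfun[OF A]) (auto simp: J_def)
  moreover have "(norm (gfun A lam \<theta>))\<^sup>2 = (norm (grad_g A lam \<theta> *v \<theta>))\<^sup>2 + lam\<^sup>2 * q"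
    if "lam \<in> seg" for lam
    using norm_gfun_formula[OF A seg[OF that]] seg(2)[OF that]
    by (simp add: grad_g_eq[OF A] q_def J_def)
  moreover have "mono_on seg (\<lambda>lam. SURE A S lam \<theta>)"
  proof (rule mono_onI)
    fix x y assume xy: "x \<in> seg" "y \<in> seg" "x \<le> y"
    then have "x\<^sup>2 * q \<le> y\<^sup>2 * q" using seg(1) q0 by (intro mult_right_mono power_mono) auto
    then show "SURE A S x \<theta> \<le> SURE A S y \<theta>" using xy by (simp add: c)
  qed
  moreover have "strict_mono_on seg (\<lambda>lam. SURE A S lam \<theta>)" if "e \<noteq> 0"
  proof (rule strict_mono_onI)
    fix x y assume xy: "x \<in> seg" "y \<in> seg" "x < y"
    then have "x\<^sup>2 * q < y\<^sup>2 * q"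
      using seg(1) q1[OF that] by (intro mult_strict_right_mono power_strict_mono) auto
    then show "SURE A S x \<theta> < SURE A S y \<theta>" using xy by (simp add: c)
  qed
  ultimately show ?thesis
    unfolding Let_def seg_def[symmetric] J_def[symmetric] q_def[symmetric] using c by blast
qed

lemma step_cost_SURE:
  assumes A: "invertible A" and S: "pos_def S"
  shows "step_cost (\<lambda>lam. 1/2 * (norm (gfun A lam \<nu>))\<^sup>2)
    (\<lambda>lam. trace (grad_formula A (active (eta A lam \<nu>)) ** S))"
proof
  show "1/2 * (norm (gfun A x \<nu>))\<^sup>2 \<le> 1/2 * (norm (gfun A y \<nu>))\<^sup>2" if "0 \<le> x" "x \<le> y" for x y
    using norm_gfun_mono[OF A that, of \<nu>] by simp
  show "continuous_on {0..} (\<lambda>lam. 1/2 * (norm (gfun A lam \<nu>))\<^sup>2)"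
    by (intro continuous_intros continuous_on_gfun_param[OF A])
  have "(\<lambda>lam. trace (grad_formula A (active (eta A lam \<nu>)) ** S)) ` {0..}
      \<subseteq> range (\<lambda>J. trace (grad_formula A J ** S))"
    by auto
  then show "finite ((\<lambda>lam. trace (grad_formula A (active (eta A lam \<nu>)) ** S)) ` {0..})"
    by (rule finite_subset) simp
  show "\<exists>d>0. \<forall>y\<ge>0. \<bar>y - x\<bar> < d \<longrightarrow>
      trace (grad_formula A (active (eta A x \<nu>)) ** S) \<le> trace (grad_formula A (active (eta A y \<nu>)) ** S)"
    if "0 \<le> x" for x
    using active_eta_lsc[OF A that, of \<nu>] trace_grad_formula_mono[OF A S] by meson
qed

theorem lemma7:
  fixes A S :: "real^'k^'k" and \<nu> :: "real^'k"
  assumes "invertible A" and "pos_def S" and "norm \<nu> = 1"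
  shows
    "(\<forall>R>0.
        (\<Union>e. segment A (R *\<^sub>R \<nu>) e) = {0..} \<and>
        (\<forall>e. segment A (R *\<^sub>R \<nu>) e \<noteq> {} \<longrightarrow> (\<forall>i. e $ i \<in> {-1, 0, 1})) \<and>
        finite {e. segment A (R *\<^sub>R \<nu>) e \<noteq> {}} \<and>
        card {e. segment A (R *\<^sub>R \<nu>) e \<noteq> {}} \<le> 3 ^ CARD('k) \<and>
        (\<forall>e. let seg = segment A (R *\<^sub>R \<nu>) e; J = active e; q = e \<bullet> (gram_inv A J *v e) in
           is_interval seg \<and>
           continuous_on seg (\<lambda>lam. SURE_polar A S lam R \<nu>) \<and>
           (\<forall>lam\<in>seg.
              grad_g A lam (R *\<^sub>R \<nu>) =
                cols A J ** gram_inv A J ** transpose (cols A J) - mat 1 \<and>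
              (0 < lam \<and>
               (\<forall>j. j \<notin> J \<longrightarrow> \<bar>column j A \<bullet> (R *\<^sub>R \<nu> - A *v hfun A lam (R *\<^sub>R \<nu>))\<bar> < lam) \<longrightarrow>
                 (gfun A lam has_derivative (*v) (grad_g A lam (R *\<^sub>R \<nu>))) (at (R *\<^sub>R \<nu>))) \<and>
              (norm (gfun A lam (R *\<^sub>R \<nu>)))\<^sup>2 =
                (norm (grad_g A lam (R *\<^sub>R \<nu>) *v (R *\<^sub>R \<nu>)))\<^sup>2 + lam\<^sup>2 * q) \<and>
           (\<exists>c. \<forall>lam\<in>seg. SURE_polar A S lam R \<nu> = c + 1/2 * lam\<^sup>2 * q) \<and>
           mono_on seg (\<lambda>lam. SURE_polar A S lam R \<nu>) \<and>
           (e \<noteq> 0 \<longrightarrow> strict_mono_on seg (\<lambda>lam. SURE_polar A S lam R \<nu>)))) \<and>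
     (\<forall>R>0. \<forall>lam\<ge>0.
        SURE_polar A S (R * lam) R \<nu> =
          1/2 * (trace S + R\<^sup>2 * (norm (gfun A lam \<nu>))\<^sup>2 + 2 * trace (grad_g A lam \<nu> ** S))) \<and>
     (\<exists>(m::nat) (l :: nat \<Rightarrow> real).
        m \<le> 3 ^ CARD('k) \<and> strict_mono_on {1..m} l \<and>
        local_minimizers (\<lambda>lam. SURE_polar A S lam 1 \<nu>) = l ` {1..m} \<and>
        (\<forall>i\<in>{1..m}. l i = 0 \<or>
           (\<forall>\<epsilon>>0. \<exists>lam\<ge>0. \<bar>lam - l i\<bar> < \<epsilon> \<and> eta A lam \<nu> \<noteq> eta A (l i) \<nu>)) \<and>
        (\<forall>R>0. local_minimizers (\<lambda>lam. SURE_polar A S lam R \<nu>) = (\<lambda>i. R * l i) ` {1..m}) \<and>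
        (\<forall>R>0. lam_opt A S R \<nu> \<in> global_minimizers (\<lambda>lam. SURE_polar A S lam R \<nu>) \<and>
           (\<forall>lam\<in>global_minimizers (\<lambda>lam. SURE_polar A S lam R \<nu>). lam_opt A S R \<nu> \<le> lam)) \<and>
        (\<exists>j :: real \<Rightarrow> nat.
           antimono_on {0<..} j \<and>
           (\<forall>R>0. j R \<in> {1..m} \<and> lam_opt A S R \<nu> = R * l (j R))) \<and>
        (let D = {R. 0 < R \<and> \<not> isCont (\<lambda>R. lam_opt A S R \<nu>) R} in
           finite D \<and> card D \<le> 3 ^ CARD('k) \<and>
           (\<forall>I. is_interval I \<and> I \<subseteq> {0<..} - D \<longrightarrow>
              (\<exists>i\<in>{1..m}. \<forall>R\<in>I. lam_opt A S R \<nu> = R * l i)) \<and>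
           (\<forall>R\<in>D. \<exists>a b. b < a \<and>
              ((\<lambda>R. lam_opt A S R \<nu>) \<longlongrightarrow> a) (at_left R) \<and>
              ((\<lambda>R. lam_opt A S R \<nu>) \<longlongrightarrow> b) (at_right R)))) \<and>
     (\<forall>R>0. isCont (\<lambda>R. lam_opt A S R \<nu>) R \<and> eta A (lam_opt A S R \<nu>) (R *\<^sub>R \<nu>) \<noteq> 0 \<longrightarrow>
        (\<forall>\<epsilon>>0.
           let U = {0..} - {lam_opt A S R \<nu> - \<epsilon>..lam_opt A S R \<nu> + \<epsilon>} in
             bdd_below ((\<lambda>lam. SURE_polar A S lam R \<nu>) ` U) \<and>
             (INF lam\<in>U. SURE_polar A S lam R \<nu>) - SURE_polar A S (lam_opt A S R \<nu>) R \<nu> > 0))"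
proof -
  note A = assms(1)
  define N T where "N lam = 1/2 * (norm (gfun A lam \<nu>))\<^sup>2"
    and "T lam = trace (grad_formula A (active (eta A lam \<nu>)) ** S)" for lam
  interpret step_cost "trace S / 2" N T
    unfolding N_def[abs_def] T_def[abs_def] by (rule step_cost_SURE[OF A assms(2)])
  let ?f = "\<lambda>R lam. SURE_polar A S lam R \<nu>"
  \<comment> \<open>In units of \<open>R\<close> the loss acquires the factor
    \<open>R\<^sup>2\<close>, while the sign vector and with it the trace term do not
    change.\<close>
  have scale: "?f R (R * lam) = cost R lam" if "0 < R" "0 \<le> lam" for R lam
    using that
    by (simp add: SURE_polar_def SURE_def grad_g_eq[OF A] eta_scale[OF A] gfun_scale[OF A]
        cost_def N_def T_def power_mult_distrib algebra_simps)
  have f_cost: "?f R lam = cost R (lam / R)" if "0 < R" "0 \<le> lam" for R lam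
    using scale[of R "lam / R"] that by simp

  have lm: "local_minimizers (?f R) = (*) R ` local_minimizers T" if "0 < R" for R
    using local_minimizers_rescale[OF that, where f = "?f R" and g = "cost R"] f_cost[OF that] local_minimizers_cost by simp
  have gm: "x \<in> global_minimizers (?f R) \<longleftrightarrow> x / R \<in> global_minimizers (cost R)" if "0 < R" for R x
    using f_cost[OF that] by (rule global_minimizers_rescale[OF that])
  define X where "X = local_minimizers T"
  \<comment> \<open>\<open>local_minimizers\<close> demands a strict inequality on the left, so
    \<open>T\<close> is larger just before a positive \<open>x\<close>; as \<open>T\<close> is a
    function of the sign vector, the latter must differ there.\<close>
  have change: "\<exists>z\<ge>0. x - \<epsilon> < z \<and> z < x \<and> eta A z \<nu> \<noteq> eta A x \<nu>"
    if x: "x \<in> X" "0 < x" and "0 < \<epsilon>" for x \<epsilon>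
  proof -
    obtain d where d: "0 < d" "\<And>y. 0 \<le> y \<Longrightarrow> \<bar>y - x\<bar> < d \<Longrightarrow> y < x \<Longrightarrow> T x < T y"
      using x(1) unfolding X_def local_minimizers_def by blast
    define z where "z = max 0 (x - min d \<epsilon> / 2)"
    have "0 \<le> z" "x - \<epsilon> < z" "z < x" "\<bar>z - x\<bar> < d"
      using x(2) \<open>0 < \<epsilon>\<close> d(1) by (auto simp: z_def)
    with d(2)[of z] show ?thesis by (auto simp: T_def)
  qed
  have X_nonneg: "0 \<le> x" if "x \<in> X" for x using that by (simp add: X_def local_minimizers_def)
  \<comment> \<open>If \<open>x < y\<close> had the same sign vector, so would everything between
    them, contrary to the change just before \<open>y\<close>.\<close>
  have inj: "inj_on (\<lambda>x. eta A x \<nu>) X"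
  proof (rule linorder_inj_onI')
    fix x y assume xy: "x \<in> X" "y \<in> X" "x < y"
    show "eta A x \<nu> \<noteq> eta A y \<nu>"
    proof
      assume eq: "eta A x \<nu> = eta A y \<nu>"
      obtain z where z: "0 \<le> z" "y - (y - x) < z" "z < y" "eta A z \<nu> \<noteq> eta A y \<nu>"
        using change[of y "y - x"] xy X_nonneg[OF xy(1)] by auto
      have "is_interval (segment A \<nu> (eta A y \<nu>))"
        unfolding is_interval_convex_1 by (rule convex_segment[OF A])
      moreover have "x \<in> segment A \<nu> (eta A y \<nu>)" "y \<in> segment A \<nu> (eta A y \<nu>)"
        using xy X_nonneg eq by (auto simp: segment_def)
      ultimately have "z \<in> segment A \<nu> (eta A y \<nu>)"
        by (rule mem_is_interval_1_I) (use z in auto)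
      with z(4) show False by (simp add: segment_def)
    qed
  qed
  have sub: "(\<lambda>x. eta A x \<nu>) ` X \<subseteq> {e. \<forall>i. e $ i \<in> {-1, 0, 1}}"
    using eta_sign by blast
  have X_fin: "finite X" and X_card: "card X \<le> 3 ^ CARD('k)"
    using inj_on_finite[OF inj sub card_sign_vectors(1)]
      order_trans[OF card_inj_on_le[OF inj sub card_sign_vectors(1)] card_sign_vectors(2)] by auto
  obtain l where l: "strict_mono_on {1..card X} l" "X = l ` {1..card X}"
    using finite_real_set_enum[OF X_fin] .

  have opt_gm: "R * opt R \<in> global_minimizers (?f R)" if "0 < R" for R
    using that by (simp add: gm opt_global_minimizer)
  have opt_le_gm: "R * opt R \<le> x" if "0 < R" "x \<in> global_minimizers (?f R)" for R x
  proof -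
    have "opt R \<le> x / R" by (rule opt_least) (use gm that in blast)
    with that(1) show ?thesis by (simp add: field_simps)
  qed
  have lam_opt: "lam_opt A S R \<nu> = R * opt R" if "0 < R" for R
    unfolding lam_opt_def by (rule Least_equality) (use that opt_gm opt_le_gm in blast)+
  have opt_X: "opt R \<in> X" for R
    using opt_local_minimizer by (simp add: X_def local_minimizers_cost)
  have anti: "antimono_on {0<..} opt"
    by (rule monotone_onI) (simp add: opt_antimono)
  have opt_sub: "opt ` {0<..} \<subseteq> X" using opt_X by auto
  have opt_fin: "finite (opt ` {0<..})" by (rule finite_subset[OF opt_sub X_fin])
  have "\<forall>R. \<exists>i\<in>{1..card X}. opt R = l i" using opt_X l(2) by (metis imageE)
  then obtain j where j: "\<And>R. j R \<in> {1..card X}" "\<And>R. opt R = l (j R)" by metis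
  have j_anti: "antimono_on {0<..} j"
  proof (rule monotone_onI)
    fix R R' :: real assume "R \<in> {0<..}" "R' \<in> {0<..}" "R \<le> R'"
    then have "l (j R') \<le> l (j R)" using opt_antimono j(2) by (metis greaterThan_iff)
    then show "j R' \<le> j R"
      using strict_mono_onD[OF l(1) j(1) j(1)] by (meson leD leI)
  qed
  note saw = sawtooth[where f = "\<lambda>R. lam_opt A S R \<nu>", OF anti opt_fin lam_opt]

  show ?thesis
  proof (intro conjI allI impI exI[of _ "card X"] exI[of _ l] exI[of _ j])
    fix R :: real and e :: "real^'k"
    show "(\<Union>e. segment A (R *\<^sub>R \<nu>) e) = {0..}"
      by (auto simp: segment_def)
    have sub: "{e. segment A (R *\<^sub>R \<nu>) e \<noteq> {}} \<subseteq> {e. \<forall>i. e $ i \<in> {-1, 0, 1}}"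
      using eta_sign by (force simp: segment_def)
    then show "finite {e. segment A (R *\<^sub>R \<nu>) e \<noteq> {}}"
      by (rule finite_subset[OF _ card_sign_vectors(1)])
    show "card {e. segment A (R *\<^sub>R \<nu>) e \<noteq> {}} \<le> 3 ^ CARD('k)"
      by (rule order_trans[OF card_mono[OF card_sign_vectors(1) sub] card_sign_vectors(2)])
    show "e $ i \<in> {-1, 0, 1}" if "segment A (R *\<^sub>R \<nu>) e \<noteq> {}" for i
      using sub that by blast
    show "let seg = segment A (R *\<^sub>R \<nu>) e; J = active e; q = e \<bullet> (gram_inv A J *v e) in
        is_interval seg \<and> continuous_on seg (?f R) \<and>
        (\<forall>lam\<in>seg.
           grad_g A lam (R *\<^sub>R \<nu>) = cols A J ** gram_inv A J ** transpose (cols A J) - mat 1 \<and>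
           (0 < lam \<and>
            (\<forall>j. j \<notin> J \<longrightarrow> \<bar>column j A \<bullet> (R *\<^sub>R \<nu> - A *v hfun A lam (R *\<^sub>R \<nu>))\<bar> < lam) \<longrightarrow>
              (gfun A lam has_derivative (*v) (grad_g A lam (R *\<^sub>R \<nu>))) (at (R *\<^sub>R \<nu>))) \<and>
           (norm (gfun A lam (R *\<^sub>R \<nu>)))\<^sup>2 =
             (norm (grad_g A lam (R *\<^sub>R \<nu>) *v (R *\<^sub>R \<nu>)))\<^sup>2 + lam\<^sup>2 * q) \<and>
        (\<exists>c. \<forall>lam\<in>seg. ?f R lam = c + 1/2 * lam\<^sup>2 * q) \<and>
        mono_on seg (?f R) \<and> (e \<noteq> 0 \<longrightarrow> strict_mono_on seg (?f R))"
      unfolding SURE_polar_def by (rule segment_properties[OF A])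
  next
    fix R lam :: real assume R: "0 < R" and lam: "0 \<le> lam"
    show "?f R (R * lam)
        = 1/2 * (trace S + R\<^sup>2 * (norm (gfun A lam \<nu>))\<^sup>2 + 2 * trace (grad_g A lam \<nu> ** S))"
      using scale[OF R lam] by (simp add: cost_def N_def T_def grad_g_eq[OF A] algebra_simps)
  next
    show "card X \<le> 3 ^ CARD('k)" by (rule X_card)
    show "strict_mono_on {1..card X} l" by (rule l(1))
    show "local_minimizers (?f 1) = l ` {1..card X}"
      using lm[of 1] l(2) by (simp add: X_def)
    show "\<forall>i\<in>{1..card X}. l i = 0 \<or>
        (\<forall>\<epsilon>>0. \<exists>lam\<ge>0. \<bar>lam - l i\<bar> < \<epsilon> \<and> eta A lam \<nu> \<noteq> eta A (l i) \<nu>)"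
    proof (intro ballI disjCI allI impI)
      fix i \<epsilon> assume i: "i \<in> {1..card X}" and e: "\<not> (\<forall>\<epsilon>>0. \<exists>lam\<ge>0. \<bar>lam - l i\<bar> < \<epsilon> \<and> eta A lam \<nu> \<noteq> eta A (l i) \<nu>)"
      have x: "l i \<in> X" using i l(2) by blast
      show "l i = 0"
      proof (rule ccontr)
        assume "l i \<noteq> 0"
        with X_nonneg[OF x] have pos: "0 < l i" by simp
        have "\<exists>lam\<ge>0. \<bar>lam - l i\<bar> < \<epsilon> \<and> eta A lam \<nu> \<noteq> eta A (l i) \<nu>" if "0 < \<epsilon>" for \<epsilon>
        proof -
          from change[OF x pos that] obtain z
            where "0 \<le> z" "l i - \<epsilon> < z" "z < l i" "eta A z \<nu> \<noteq> eta A (l i) \<nu>" by blast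
          then show ?thesis by (intro exI[of _ z]) auto
        qed
        with e show False by blast
      qed
    qed
  next
    fix R :: real assume R: "0 < R"
    show "local_minimizers (?f R) = (\<lambda>i. R * l i) ` {1..card X}"
      by (subst lm[OF R], subst X_def[symmetric], subst l(2)) (simp add: image_image)
    show "lam_opt A S R \<nu> \<in> global_minimizers (?f R)"
      unfolding lam_opt[OF R] by (rule opt_gm[OF R])
    show "\<forall>lam\<in>global_minimizers (?f R). lam_opt A S R \<nu> \<le> lam"
      unfolding lam_opt[OF R] using opt_le_gm[OF R] by blast
  next
    show "antimono_on {0<..} j" by (rule j_anti)
    show "j R \<in> {1..card X}" for R by (rule j(1))
    show "lam_opt A S R \<nu> = R * l (j R)" if "0 < R" for R
      using lam_opt[OF that] j(2) by simp
  next
    define D where "D = {R. 0 < R \<and> \<not> isCont (\<lambda>R. lam_opt A S R \<nu>) R}"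
    have "finite D" unfolding D_def by (rule saw(1))
    moreover have "card D \<le> 3 ^ CARD('k)"
      unfolding D_def by (rule order_trans[OF saw(2) order_trans[OF card_mono[OF X_fin opt_sub] X_card]])
    moreover have "\<exists>i\<in>{1..card X}. \<forall>R\<in>I. lam_opt A S R \<nu> = R * l i"
      if I: "is_interval I" "I \<subseteq> {0<..} - D" for I
    proof -
      have "I \<subseteq> {R. 0 < R \<and> isCont (\<lambda>R. lam_opt A S R \<nu>) R}"
        using I(2) by (auto simp: D_def)
      from sawtooth_linear_piece[where f = "\<lambda>R. lam_opt A S R \<nu>", OF anti opt_fin lam_opt I(1) this]
      obtain v where v: "v \<in> opt ` {0<..}" "\<forall>R\<in>I. lam_opt A S R \<nu> = R * v" by blast
      then have "v \<in> l ` {1..card X}"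
        using opt_sub by (intro equalityD1[OF l(2), THEN subsetD]) (rule subsetD)
      with v(2) show ?thesis by blast
    qed
    moreover have "\<exists>a b. b < a \<and> ((\<lambda>R. lam_opt A S R \<nu>) \<longlongrightarrow> a) (at_left R) \<and>
        ((\<lambda>R. lam_opt A S R \<nu>) \<longlongrightarrow> b) (at_right R)" if "R \<in> D" for R
      by (rule saw(3)[OF _ that[unfolded D_def]])
    ultimately show "let D = {R. 0 < R \<and> \<not> isCont (\<lambda>R. lam_opt A S R \<nu>) R} in
           finite D \<and> card D \<le> 3 ^ CARD('k) \<and>
           (\<forall>I. is_interval I \<and> I \<subseteq> {0<..} - D \<longrightarrow>
              (\<exists>i\<in>{1..card X}. \<forall>R\<in>I. lam_opt A S R \<nu> = R * l i)) \<and>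
           (\<forall>R\<in>D. \<exists>a b. b < a \<and>
              ((\<lambda>R. lam_opt A S R \<nu>) \<longlongrightarrow> a) (at_left R) \<and>
              ((\<lambda>R. lam_opt A S R \<nu>) \<longlongrightarrow> b) (at_right R))"
      unfolding Let_def D_def[symmetric] by blast
  next
    fix R \<epsilon> :: real
    assume R: "0 < R" and "isCont (\<lambda>R. lam_opt A S R \<nu>) R \<and> eta A (lam_opt A S R \<nu>) (R *\<^sub>R \<nu>) \<noteq> 0"
      and eps: "0 < \<epsilon>"
    then have cont: "isCont (\<lambda>R. lam_opt A S R \<nu>) R" and nz: "eta A (opt R) \<nu> \<noteq> 0"
      by (auto simp: lam_opt eta_scale[OF A opt_nonneg R])
    \<comment> \<open>Continuity of \<open>lam_opt\<close> at \<open>R\<close> makes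
      \<open>opt\<close> constant nearby, so a slightly smaller radius has the same rescaled
      minimizer, as \<open>well_separated\<close> requires.\<close>
    obtain d where d: "0 < d" "\<And>r. dist r R < d \<Longrightarrow> opt r = opt R"
      using saw(4)[OF _ R cont] by (auto simp: eventually_nhds_metric)
    \<comment> \<open>The first term keeps \<open>R'\<close> positive, the second keeps it within
      \<open>d\<close> of \<open>R\<close>.\<close>
    define R' where "R' = max (R / 2) (R - d / 2)"
    have R': "0 < R'" "R' < R" "opt R' = opt R"
      using R d(1) by (auto simp: R'_def dist_real_def intro!: d(2))
    have "N (opt R) < N y" if "opt R < y" for y
      using norm_gfun_strict_mono[OF A opt_nonneg that nz] by (simp add: N_def)
    from well_separated[OF R' this, of "\<epsilon> / R"] obtain \<delta> where \<delta>: "0 < \<delta>"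
      "\<And>y. 0 \<le> y \<Longrightarrow> \<epsilon> / R \<le> \<bar>y - opt R\<bar> \<Longrightarrow> cost R (opt R) + \<delta> \<le> cost R y"
      using R eps by auto
    define U where "U = {0..} - {lam_opt A S R \<nu> - \<epsilon>..lam_opt A S R \<nu> + \<epsilon>}"
    have bound: "?f R (lam_opt A S R \<nu>) + \<delta> \<le> ?f R lam" if lam: "lam \<in> U" for lam
    proof -
      have lam': "0 \<le> lam" "\<epsilon> < \<bar>lam - R * opt R\<bar>"
        using lam by (auto simp: U_def lam_opt[OF R])
      have "lam / R - opt R = (lam - R * opt R) / R"
        using R by (simp add: field_simps)
      then have "\<epsilon> / R \<le> \<bar>lam / R - opt R\<bar>"
        using lam'(2) R by (simp add: abs_divide divide_right_mono)
      from \<delta>(2)[OF _ this] show ?thesis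
        using f_cost[OF R lam'(1)] scale[OF R opt_nonneg] lam'(1) R by (simp add: lam_opt[OF R])
    qed
    \<comment> \<open>A witness that \<open>U\<close> is nonempty; the uniform bound passes to the
      infimum only then.\<close>
    have "lam_opt A S R \<nu> + \<epsilon> + 1 \<in> U"
      using eps R opt_nonneg by (auto simp: U_def lam_opt[OF R])
    then have "?f R (lam_opt A S R \<nu>) + \<delta> \<le> (INF lam\<in>U. ?f R lam)"
      using bound by (intro cINF_greatest) auto
    moreover have "bdd_below (?f R ` U)"
      using bound by (rule bdd_belowI2)
    ultimately show "let U = {0..} - {lam_opt A S R \<nu> - \<epsilon>..lam_opt A S R \<nu> + \<epsilon>} in
        bdd_below (?f R ` U) \<and> (INF lam\<in>U. ?f R lam) - ?f R (lam_opt A S R \<nu>) > 0"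
      using \<delta>(1) by (simp add: Let_def U_def[symmetric])
  qed
qed

end
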